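(* Let $d \geq 1$ and $T \geq 1$ be integers, let $M>0$ and $L \ge 0$, and let $\ell:[0,1]^2\to[0,1]$ be convex and $M$-Lipschitz in its first argument. Let $(\boldsymbol{x}_t,y_t)_{t=1}^T$ be any sequence in $[0,1]^d\times[0,1]$, and let $\hat y_1,\dots,\hat y_T$ be the predictions of the nested EG strategy (with parameter $M$) on this sequence. Let $N_T$ denote the number of nodes of the tree $\mathcal{T}_T$ stored by the nested EG strategy. Then \[ \sum_{t=1}^T \ell(\hat y_t, y_t) - \inf_{f \in \mathcal{L}_L^d} \sum_{t=1}^T \ell\bigl(f(\boldsymbol{x}_t), y_t\bigr) \leq M(3+L)\sqrt{N_T T} \leq M(3+L)\Bigl(\sqrt{T} + 2(3d)^{\frac{d}{2(d+2)}}\,T^{\frac{d+1}{d+2}}\Bigr). \]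
   Context: Protocol: at each time step $t=1,2,\dots$ the forecaster observes $\boldsymbol{x}_t\in[0,1]^d$, predicts $\hat y_t\in[0,1]$, the environment then chooses $y_t\in[0,1]$, and the forecaster suffers loss $\ell(\hat y_t,y_t)$. $\mathcal{L}_L^d$ is the set of functions $[0,1]^d\to[0,1]$ that are $L$-Lipschitz for the Euclidean norm. For a set $A$, $\operatorname{diam}(A)=\sup_{\boldsymbol{x},\boldsymbol{x}'\in A}\|\boldsymbol{x}-\boldsymbol{x}'\|_2$. EG forecaster (with parameter $M$): run on a sequence $y_1,y_2,\dots\in[0,1]$, it uses $\eta_t = M^{-1}\sqrt{(\log 2)/t}$ and at step $t$ predicts \[\hat y_t=\frac{\exp(-\eta_t\sum_{s=1}^{t-1}\ell'(\hat y_s,y_s))}{1+\exp(-\eta_t\sum_{s=1}^{t-1}\ell'(\hat y_s,y_s))},\] where $\ell'$ is a (sub)gradient of $\ell$ with respect to its first argument; then it observes $y_t$. Regions: to each pair $(h,i)$ with $h\ge0$, $1\le i\le 2^h$, a hyper-rectangle $\mathcal{X}^{(h,i)}\subset[0,1]^d$ is attached recursively. $\mathcal{X}^{(0,1)}=[0,1]^d$. Given $\mathcal{X}^{(h,i)}$, write $h=kd+r$ with $r\in\{0,\dots,d-1\}$, let $x^-$ and $x^+$ be the infimum and supremum of the coordinate $x_{r+1}$ over $\mathcal{X}^{(h,i)}$, and $\tau=(x^-+x^+)/2$. Then $\mathcal{X}^{(h+1,2i-1)}=\{\boldsymbol{x}\in\mathcal{X}^{(h,i)}: x_{r+1}\in[x^-,\tau)\}$,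 and $\mathcal{X}^{(h+1,2i)}=\{\boldsymbol{x}\in\mathcal{X}^{(h,i)}: x_{r+1}\in[\tau,x^+)\}$ if $x^+<1$, respectively $\{\boldsymbol{x}\in\mathcal{X}^{(h,i)}: x_{r+1}\in[\tau,1]\}$ if $x^+=1$. Nested EG strategy: it maintains a finite binary tree $\mathcal{T}$ of nodes $(h,i)$, where $(h+1,2i-1)$ and $(h+1,2i)$ are the children of $(h,i)$; initially $\mathcal{T}=\{(0,1)\}$. Each node $(h,i)$, when created, is given a fresh copy $\mathcal{E}^{(h,i)}$ of the EG forecaster. At each step $t$: observe $\boldsymbol{x}_t$; let $(h_t,i_t)$ be the leaf of $\mathcal{T}$ with $\boldsymbol{x}_t\in\mathcal{X}^{(h_t,i_t)}$; predict $\hat y_t$ according to $\mathcal{E}^{(h_t,i_t)}$; observe $y_t$ and feed it to $\mathcal{E}^{(h_t,i_t)}$; set $T^{(h_t,i_t)}=\#\{1\le s\le t:(h_s,i_s)=(h_t,i_t)\}$; if $T^{(h_t,i_t)}+1\ge \operatorname{diam}(\mathcal{X}^{(h_t,i_t)})^{-2}$, add the two children of $(h_t,i_t)$ to $\mathcal{T}$ (so $(h_t,i_t)$ becomes an inner node and is no longer used for prediction). $\mathcal{T}_t$ denotes the tree stored at the beginning of time step $t$. *)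

theory Defs
  imports "HOL-Analysis.Analysis"
begin

definition subgradient_at :: "real set \<Rightarrow> (real \<Rightarrow> real) \<Rightarrow> real \<Rightarrow> real \<Rightarrow> bool" where
  "subgradient_at S f a v \<longleftrightarrow> (\<forall>z\<in>S. f a + v * (z - a) \<le> f z)"

text \<open>The cube is \<open>cbox 0 1\<close> in \<open>real ^ 'n\<close>, with \<open>d = CARD('n)\<close>. Values of \<open>f\<close> outside the
  cube are irrelevant; \<open>lipschitz_on\<close> uses the Euclidean distance of \<open>real ^ 'n\<close>.\<close>

definition lipschitz_class :: "real \<Rightarrow> (real ^ 'n::finite \<Rightarrow> real) set" where
  "lipschitz_class L = {f. f ` cbox 0 1 \<subseteq> {0..1} \<and> L-lipschitz_on (cbox 0 1) f}"

text \<open>Prediction of the EG forecaster at step \<open>t \<ge> 1\<close> on the sequence \<open>y 1, y 2, \<dots>\<close>; the function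
  \<open>g\<close> is the chosen subgradient of the loss in its first argument. Only \<open>y 1, \<dots>, y (t - 1)\<close> matter.\<close>

definition eg_rate :: "real \<Rightarrow> nat \<Rightarrow> real" where
  "eg_rate M t = sqrt (ln 2 / real t) / M"

function eg_predict :: "real \<Rightarrow> (real \<Rightarrow> real \<Rightarrow> real) \<Rightarrow> (nat \<Rightarrow> real) \<Rightarrow> nat \<Rightarrow> real" where
  "eg_predict M g y t =
    (let w = exp (- eg_rate M t * (\<Sum>s\<in>{1..<t}. g (eg_predict M g y s) (y s))) in w / (1 + w))"
  by pat_completeness auto
termination
  by (relation "Wellfounded.measure (\<lambda>(M, g, y, t). t)") auto

declare eg_predict.simps [simp del]

definition lower_half :: "'n \<Rightarrow> (real ^ 'n::finite) set \<Rightarrow> (real ^ 'n) set" where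
  "lower_half c X =
    (let lo = (INF x\<in>X. x $ c); hi = (SUP x\<in>X. x $ c); \<tau> = (lo + hi) / 2
     in {x \<in> X. lo \<le> x $ c \<and> x $ c < \<tau>})"

definition upper_half :: "'n \<Rightarrow> (real ^ 'n::finite) set \<Rightarrow> (real ^ 'n) set" where
  "upper_half c X =
    (let lo = (INF x\<in>X. x $ c); hi = (SUP x\<in>X. x $ c); \<tau> = (lo + hi) / 2
     in if hi < 1 then {x \<in> X. \<tau> \<le> x $ c \<and> x $ c < hi}
        else {x \<in> X. \<tau> \<le> x $ c \<and> x $ c \<le> 1})"

text \<open>The map \<open>e\<close> enumerates the coordinates: the coordinate \<open>x_{r+1}\<close> is \<open>x $ e r\<close> for
  \<open>r < CARD('n)\<close>. A node \<open>(h, i)\<close> satisfies \<open>1 \<le> i \<le> 2 ^ h\<close> and has the children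
  \<open>(h + 1, 2 i - 1)\<close> and \<open>(h + 1, 2 i)\<close>, so the parent of \<open>(h + 1, j)\<close> is \<open>(h, (j + 1) div 2)\<close>.\<close>

fun region :: "(nat \<Rightarrow> 'n) \<Rightarrow> nat \<times> nat \<Rightarrow> (real ^ 'n::finite) set" where
  "region e (0, i) = cbox 0 1"
| "region e (Suc h, j) =
    (if odd j then lower_half (e (h mod CARD('n))) (region e (h, (j + 1) div 2))
     else upper_half (e (h mod CARD('n))) (region e (h, (j + 1) div 2)))"

lemma region_children:
  fixes e :: "nat \<Rightarrow> 'n::finite"
  assumes "1 \<le> i"
  shows "region e (Suc h, 2 * i - 1) = lower_half (e (h mod CARD('n))) (region e (h, i))"
    and "region e (Suc h, 2 * i) = upper_half (e (h mod CARD('n))) (region e (h, i))"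
  using assms by (auto simp: Suc_diff_Suc)

definition children :: "nat \<times> nat \<Rightarrow> (nat \<times> nat) set" where
  "children n = (case n of (h, i) \<Rightarrow> {(Suc h, 2 * i - 1), (Suc h, 2 * i)})"

definition leaves :: "(nat \<times> nat) set \<Rightarrow> (nat \<times> nat) set" where
  "leaves \<T> = {n \<in> \<T>. children n \<inter> \<T> = {}}"

text \<open>Times start at \<open>1\<close>. \<open>nested_tree e x t\<close> is the tree stored at the beginning of step \<open>t\<close> (its
  value at \<open>t = 0\<close> is a dummy) and \<open>nested_leaf e x t\<close> is the leaf \<open>(h_t, i_t)\<close> used at step \<open>t\<close>.
  Neither depends on the outcomes \<open>y\<close>. The length of the filtered list is the number of
  \<open>s \<in> {1..t}\<close> with \<open>(h_s, i_s) = (h_t, i_t)\<close>.\<close>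

function nested_tree :: "(nat \<Rightarrow> 'n) \<Rightarrow> (nat \<Rightarrow> real ^ 'n::finite) \<Rightarrow> nat \<Rightarrow> (nat \<times> nat) set"
  and nested_leaf :: "(nat \<Rightarrow> 'n) \<Rightarrow> (nat \<Rightarrow> real ^ 'n::finite) \<Rightarrow> nat \<Rightarrow> nat \<times> nat" where
  "nested_tree e x 0 = {(0, 1)}"
| "nested_tree e x (Suc t) =
    (if t = 0 then {(0, 1)}
     else if real (length (filter (\<lambda>s. nested_leaf e x s = nested_leaf e x t) [1..<Suc t])) + 1
               \<ge> 1 / (diameter (region e (nested_leaf e x t)))\<^sup>2
     then nested_tree e x t \<union> children (nested_leaf e x t)
     else nested_tree e x t)"
| "nested_leaf e x t = (THE n. n \<in> leaves (nested_tree e x t) \<and> x t \<in> region e n)"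
  by pat_completeness auto
termination
  by (relation "Wellfounded.measure (\<lambda>p. case p of Inl (e, x, t) \<Rightarrow> 2 * t | Inr (e, x, t) \<Rightarrow> 2 * t + 1)") auto

declare nested_tree.simps [simp del] nested_leaf.simps [simp del]

text \<open>At step \<open>t\<close> the copy of EG attached to the leaf \<open>(h_t, i_t)\<close> has been fed, in order of time,
  the outcomes \<open>y s\<close> of the earlier steps \<open>s\<close> at which this same leaf was used.\<close>

definition nested_predict ::
  "(nat \<Rightarrow> 'n) \<Rightarrow> real \<Rightarrow> (real \<Rightarrow> real \<Rightarrow> real) \<Rightarrow> (nat \<Rightarrow> real ^ 'n::finite) \<Rightarrow> (nat \<Rightarrow> real) \<Rightarrow> nat \<Rightarrow> real"
  where
  "nested_predict e M g x y t =
    (let ys = map y (filter (\<lambda>s. nested_leaf e x s = nested_leaf e x t) [1..<t])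
     in eg_predict M g (\<lambda>k. ys ! (k - 1)) (length ys + 1))"

end

theory Submission
  imports Defs
begin

text \<open>
  The strategy competes, on every leaf of its tree, with the best constant prediction, and the tree
  is refined at exactly the rate at which constants stop being good enough.

  \<^item> One copy of EG, used \<open>m\<close> times, has regret at most \<open>3 M sqrt m\<close> against each constant
    (\<open>eg_regret\<close>). Subgradients turn the loss into a linear one; then a prediction in
    \<open>[0, 1]\<close> acts as a mixture of two experts predicting \<open>0\<close> and \<open>1\<close>, and the log-sum-exp
    potential \<open>eg_potential\<close> of this pair controls the regret. It is monotone in the learning rate,
    so lowering the rate over time costs nothing.
  \<^item> Replacing \<open>f\<close> on a region by its value at the first point seen there costs at most \<open>M L diam\<close> per
    later step. A node that is used \<open>m \<ge> 2\<close> times was not split after use \<open>m - 1\<close>, hence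
    \<open>m < 1 / diam\<^sup>2\<close> and this cost is at most \<open>M L sqrt m\<close> in total (\<open>leaf_regret\<close>).
  \<^item> Every step uses exactly one node of the final tree, so the numbers of uses add up to \<open>T\<close>, and the
    Cauchy-Schwarz inequality gives \<open>M (3 + L) sqrt (N T)\<close> (\<open>nested_regret\<close>). This needs the regions of the
    leaves to partition the cube (\<open>split_tree_unique_leaf\<close>).

  To bound the number \<open>N\<close> of nodes of the final tree, note that \<open>N \<le> 1 + 2 I\<close> for the number \<open>I\<close> of
  split nodes, and that a split node was used at least \<open>max 1 (diam\<^sup>-\<^sup>2 - 1) \<ge> diam\<^sup>-\<^sup>2 / 2\<close> times. At depth \<open>h\<close> the squared diameter is of order
  \<open>d 4\<^sup>-\<^sup>h\<^sup>/\<^sup>d\<close> (\<open>diameter_le_powr\<close>), and there are at most \<open>2\<^sup>h\<close> nodes of depth \<open>h\<close>. Many split nodes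
  therefore use up many steps: numbering the nodes \<open>1, 2, 3, \<dots>\<close> in breadth-first order, the node with number \<open>v\<close>
  accounts for at least a constant times \<open>v\<^sup>2\<^sup>/\<^sup>d\<close> steps, and summing over \<open>I\<close> distinct numbers shows
  that a constant times \<open>I\<^sup>1\<^sup>+\<^sup>2\<^sup>/\<^sup>d\<close> is at most \<open>T\<close> (\<open>card_inner_nodes_le\<close>).
\<close>

section \<open>Regret of the EG forecaster\<close>

text \<open>This replaces Hoeffding's lemma. It is cruder (a constant \<open>1\<close> instead of \<open>1 / 8\<close> in front of
  the learning rate), but the constant \<open>3\<close> in the final bound leaves room for it.\<close>

lemma exp_minus_le_quadratic:
  fixes z :: real
  assumes "\<bar>z\<bar> \<le> 1"
  shows "exp (- z) \<le> 1 - z + z\<^sup>2"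
proof (cases "z \<le> 0")
  case True
  then show ?thesis using exp_bound[of "- z"] assms by simp
next
  case False
  then have z: "0 \<le> z" by simp
  have "1 \<le> 1 + (z\<^sup>2 + z ^ 3 + z ^ 4) / 2" using z by simp
  also have "\<dots> = (1 - z + z\<^sup>2) * (1 + z + z\<^sup>2 / 2)"
    by (simp add: field_simps power2_eq_square power3_eq_cube power4_eq_xxxx)
  also have "\<dots> \<le> (1 - z + z\<^sup>2) * exp z"
  proof (rule mult_left_mono)
    show "1 + z + z\<^sup>2 / 2 \<le> exp z" using exp_lower_Taylor_quadratic[OF z] .
    show "0 \<le> 1 - z + z\<^sup>2" using assms by simp
  qed
  finally show ?thesis by (simp add: exp_minus field_simps)
qed

text \<open>The normalised log-partition function of two experts with cumulative losses \<open>0\<close> and \<open>G\<close> and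
  uniform prior, at learning rate \<open>\<eta>\<close>. The EG prediction is minus its derivative in \<open>G\<close>.\<close>

definition eg_potential :: "real \<Rightarrow> real \<Rightarrow> real" where
  "eg_potential \<eta> G = ln ((1 + exp (- \<eta> * G)) / 2) / \<eta>"

text \<open>The function \<open>\<eta> \<mapsto> ln E[exp (\<eta> X)]\<close> is convex and vanishes at \<open>0\<close>, so its quotient by \<open>\<eta>\<close> is
  nondecreasing; here \<open>X\<close> is \<open>0\<close> or \<open>- G\<close> with probability \<open>1 / 2\<close> each. The convexity reduces to that
  of \<open>exp\<close>, applied between the logarithm of the mean at rate \<open>\<eta>'\<close> and each of the two values of \<open>\<eta>' X\<close>.\<close>

lemma eg_potential_mono_rate:
  assumes "0 < \<eta>" "\<eta> \<le> \<eta>'"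
  shows "eg_potential \<eta> G \<le> eg_potential \<eta>' G"
proof -
  define \<theta> where "\<theta> = \<eta> / \<eta>'"
  define m where "m = (1 + exp (- \<eta>' * G)) / 2"
  have \<eta>': "0 < \<eta>'" and \<theta>: "0 \<le> \<theta>" "\<theta> \<le> 1" using assms by (auto simp: \<theta>_def)
  have m: "0 < m" by (simp add: m_def add_pos_pos)
  have jensen: "exp ((1 - \<theta>) * ln m) * exp (\<theta> * z) \<le> (1 - \<theta>) * m + \<theta> * exp z" for z
    using convex_onD[OF exp_convex \<theta>, of "ln m" z] m by (simp add: exp_add[symmetric])
  have e: "\<theta> * (- \<eta>' * G) = - \<eta> * G" using \<eta>' by (simp add: \<theta>_def)
  define K where "K = exp ((1 - \<theta>) * ln m)"
  have "K * (1 + exp (- \<eta> * G)) = K * exp (\<theta> * 0) + K * exp (- \<eta> * G)"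
    by (simp add: algebra_simps)
  also have "\<dots> \<le> ((1 - \<theta>) * m + \<theta> * exp 0) + ((1 - \<theta>) * m + \<theta> * exp (- \<eta>' * G))"
    unfolding K_def e[symmetric] by (intro add_mono jensen)
  also have "\<dots> = 2 * (1 - \<theta>) * m + \<theta> * (1 + exp (- \<eta>' * G))" by (simp add: algebra_simps)
  also have "1 + exp (- \<eta>' * G) = 2 * m" by (simp add: m_def)
  also have "2 * (1 - \<theta>) * m + \<theta> * (2 * m) = 2 * m" by (simp add: algebra_simps)
  finally have "exp ((1 - \<theta>) * ln m) * (1 + exp (- \<eta> * G)) \<le> 2 * m" by (simp only: K_def)
  then have "exp ((1 - \<theta>) * ln m) * ((1 + exp (- \<eta> * G)) / 2) \<le> m" by simp
  then have "ln (exp ((1 - \<theta>) * ln m) * ((1 + exp (- \<eta> * G)) / 2)) \<le> ln m"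
    using m by (subst ln_le_cancel_iff) (auto intro!: mult_pos_pos add_pos_pos)
  then have "(1 - \<theta>) * ln m + ln ((1 + exp (- \<eta> * G)) / 2) \<le> ln m"
    by (subst (asm) ln_mult_pos) (auto simp: add_pos_pos)
  then have "ln ((1 + exp (- \<eta> * G)) / 2) \<le> \<theta> * ln m" by (simp add: algebra_simps)
  then have "ln ((1 + exp (- \<eta> * G)) / 2) / \<eta> \<le> \<theta> * ln m / \<eta>"
    using assms by (intro divide_right_mono) auto
  also have "\<dots> = ln m / \<eta>'" using assms by (simp add: \<theta>_def)
  finally show ?thesis by (simp add: eg_potential_def m_def)
qed

text \<open>The regret against the constant \<open>a\<close> is read off from this: the partition function dominates
  the contribution of the better expert, hence that of each mixture of the two.\<close>

lemma eg_potential_lower: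
  assumes "0 < \<eta>" "a \<in> {0..1}"
  shows "- (ln 2 / \<eta>) - a * G \<le> eg_potential \<eta> G"
proof -
  define w where "w = - \<eta> * G"
  have "exp (a * w) \<le> 1 + exp w"
  proof (cases "0 \<le> w")
    case True
    then have "exp (a * w) \<le> exp w" using assms by (simp add: mult_left_le_one_le)
    then show ?thesis by linarith
  next
    case False
    then have "exp (a * w) \<le> 1" using assms by (simp add: mult_nonneg_nonpos)
    then show ?thesis using exp_ge_zero[of w] by linarith
  qed
  then have "a * w \<le> ln (1 + exp w)" by (subst ln_ge_iff) (auto simp: add_pos_pos)
  moreover have "ln ((1 + exp w) / 2) = ln (1 + exp w) - ln 2"
    by (rule ln_divide_pos) (auto simp: add_pos_pos)
  ultimately have "(a * w - ln 2) / \<eta> \<le> ln ((1 + exp w) / 2) / \<eta>"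
    using assms by (intro divide_right_mono) auto
  then have "(a * w - ln 2) / \<eta> \<le> eg_potential \<eta> G" by (simp only: eg_potential_def w_def)
  then show ?thesis using assms by (simp add: w_def field_simps)
qed

text \<open>One step of EG: up to a second-order term, the loss \<open>g p\<close> of the prediction \<open>p\<close> is paid for by the
  decrease of the potential. The ratio of consecutive partition functions is the \<open>p\<close>-average of
  \<open>exp (- \<eta> g X)\<close> for a Bernoulli variable \<open>X\<close>.\<close>

lemma eg_potential_step:
  assumes "0 < \<eta>" "\<bar>\<eta> * g\<bar> \<le> 1"
  shows "g * (exp (- \<eta> * G) / (1 + exp (- \<eta> * G)))
    \<le> eg_potential \<eta> G - eg_potential \<eta> (G + g) + \<eta> * g\<^sup>2"
proof -
  define w where "w = exp (- \<eta> * G)"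
  define p where "p = w / (1 + w)"
  define z where "z = \<eta> * g"
  have w: "0 < w" by (simp add: w_def)
  have p: "0 \<le> p" "p \<le> 1" using w by (auto simp: p_def)
  have w': "exp (- \<eta> * (G + g)) = w * exp (- z)" by (simp add: w_def z_def exp_add[symmetric] algebra_simps)
  have "(1 + w * exp (- z)) / (1 + w) = 1 + p * (exp (- z) - 1)"
    using w by (simp add: p_def field_simps)
  also have "\<dots> \<le> 1 + p * (- z + z\<^sup>2)"
    using exp_minus_le_quadratic[of z] assms p by (intro add_left_mono mult_left_mono) (auto simp: z_def)
  also have "\<dots> \<le> 1 + (- p * z + z\<^sup>2)"
    using mult_right_mono[of p 1 "z\<^sup>2"] p by (simp add: algebra_simps)
  also have "\<dots> \<le> exp (- p * z + z\<^sup>2)" by (rule exp_ge_add_one_self)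
  finally have le: "(1 + w * exp (- z)) / (1 + w) \<le> exp (- p * z + z\<^sup>2)" .
  have pos: "0 < 1 + w * exp (- z)" "0 < 1 + w" using w by (auto intro!: add_pos_pos mult_pos_pos)
  have "ln ((1 + w * exp (- z)) / (1 + w)) \<le> - p * z + z\<^sup>2"
    using le pos by (metis divide_pos_pos exp_ln exp_le_cancel_iff)
  then have "ln ((1 + w * exp (- z)) / 2) - ln ((1 + w) / 2) \<le> - p * z + z\<^sup>2"
    using pos by (simp add: ln_div)
  then have "(ln ((1 + w * exp (- z)) / 2) - ln ((1 + w) / 2)) / \<eta> \<le> (- p * z + z\<^sup>2) / \<eta>"
    using assms by (intro divide_right_mono) auto
  also have "\<dots> = - g * p + \<eta> * g\<^sup>2"
    using assms by (simp add: z_def field_simps power2_eq_square)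
  finally have "eg_potential \<eta> (G + g) - eg_potential \<eta> G \<le> - g * p + \<eta> * g\<^sup>2"
    by (simp only: eg_potential_def w' w_def[symmetric] diff_divide_distrib)
  then have "g * p \<le> eg_potential \<eta> G - eg_potential \<eta> (G + g) + \<eta> * g\<^sup>2" by linarith
  then show ?thesis by (simp only: p_def w_def)
qed

lemma sum_inverse_sqrt_le: "(\<Sum>k=1..m. 1 / sqrt (real k)) \<le> 2 * sqrt (real m)"
proof (induction m)
  case (Suc m)
  define a b where "a = sqrt (real m)" and "b = sqrt (real (Suc m))"
  have b: "b > 0" "b\<^sup>2 = a\<^sup>2 + 1" "0 \<le> a" by (auto simp: a_def b_def)
  have "2 * (a * b) \<le> a\<^sup>2 + b\<^sup>2" using sum_squares_bound[of a b] by simp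
  then have "2 * a * b + 1 \<le> 2 * b * b" using b by (simp add: power2_eq_square)
  then have "2 * a + 1 / b \<le> 2 * b" using b by (simp add: field_simps)
  then show ?case using Suc by (simp add: a_def b_def)
qed simp

lemma eg_rate_pos: "M > 0 \<Longrightarrow> k \<ge> 1 \<Longrightarrow> 0 < eg_rate M k"
  by (simp add: eg_rate_def)

lemma eg_rate_antimono: "M > 0 \<Longrightarrow> 1 \<le> j \<Longrightarrow> j \<le> k \<Longrightarrow> eg_rate M k \<le> eg_rate M j"
  by (auto simp: eg_rate_def intro!: divide_right_mono divide_left_mono)

lemma eg_rate_le: assumes "M > 0" "k \<ge> 1" shows "eg_rate M k * M \<le> 1 / sqrt (real k)"
proof -
  have "ln 2 / real k \<le> 1 / real k" using ln_le_minus_one[of 2] assms by (intro divide_right_mono) auto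
  then have "sqrt (ln 2 / real k) \<le> sqrt (1 / real k)" by simp
  then show ?thesis using assms by (simp add: eg_rate_def real_sqrt_divide)
qed

text \<open>Telescoping the steps leaves the final potential, which costs \<open>ln 2 / \<eta>\<^sub>m\<close>, and the sum
  of the second-order terms; with rates of order \<open>1 / (M sqrt k)\<close> these are at most \<open>M sqrt m\<close> and \<open>2 M sqrt m\<close>.\<close>

lemma eg_linear_regret:
  fixes g p :: "nat \<Rightarrow> real"
  assumes M: "M > 0" and g: "\<And>k. k \<in> {1..m} \<Longrightarrow> \<bar>g k\<bar> \<le> M"
    and p: "\<And>k. k \<in> {1..m} \<Longrightarrow>
      p k = (let w = exp (- eg_rate M k * (\<Sum>s\<in>{1..<k}. g s)) in w / (1 + w))"
    and a: "a \<in> {0..1}"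
  shows "(\<Sum>k=1..m. g k * (p k - a)) \<le> 3 * M * sqrt (real m)"
proof (cases "m = 0")
  case False
  \<comment> \<open>Quantifying over all rates below the current one lets the induction switch to the smaller rate of
    the next step. The case \<open>j = 0\<close> is separate because \<open>eg_rate M 0 = 0\<close>.\<close>
  have "(\<Sum>k=1..j. g k * p k)
      \<le> - eg_potential \<eta> (\<Sum>k=1..j. g k) + M\<^sup>2 * (\<Sum>k=1..j. eg_rate M k)"
    if "j \<le> m" "0 < \<eta>" "j = 0 \<or> \<eta> \<le> eg_rate M j" for j \<eta>
    using that
  proof (induction j arbitrary: \<eta>)
    case 0
    then show ?case by (simp add: eg_potential_def)
  next
    case (Suc j)
    define r where "r = eg_rate M (Suc j)"
    have r: "0 < r" using M by (simp add: r_def eg_rate_pos)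
    have gj: "\<bar>g (Suc j)\<bar> \<le> M" using g Suc by simp
    have IH: "(\<Sum>k=1..j. g k * p k)
      \<le> - eg_potential r (\<Sum>k=1..j. g k) + M\<^sup>2 * (\<Sum>k=1..j. eg_rate M k)"
      using Suc.prems r M unfolding r_def
      by (intro Suc.IH) (cases "j = 0"; auto intro: eg_rate_antimono)+
    have "r * M \<le> 1 / sqrt (real (Suc j))" using eg_rate_le[OF M, of "Suc j"] by (simp add: r_def)
    also have "\<dots> \<le> 1" by simp
    finally have "r * M \<le> 1" .
    then have "\<bar>r * g (Suc j)\<bar> \<le> 1"
      using mult_left_mono[OF gj, of r] r unfolding abs_mult by linarith
    then have "g (Suc j) * p (Suc j) \<le> eg_potential r (\<Sum>k=1..j. g k)
        - eg_potential r ((\<Sum>k=1..j. g k) + g (Suc j)) + r * (g (Suc j))\<^sup>2"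
      using eg_potential_step[OF r, of "g (Suc j)" "\<Sum>k=1..j. g k"] p[of "Suc j"] Suc.prems
      by (simp add: r_def Let_def atLeastLessThanSuc_atLeastAtMost)
    moreover have "r * (g (Suc j))\<^sup>2 \<le> r * M\<^sup>2"
      using gj M r by (intro mult_left_mono) (auto simp: abs_le_square_iff[symmetric])
    moreover have "eg_potential \<eta> (\<Sum>k=1..Suc j. g k) \<le> eg_potential r (\<Sum>k=1..Suc j. g k)"
      using Suc.prems by (intro eg_potential_mono_rate) (auto simp: r_def)
    ultimately show ?case using IH by (simp add: r_def algebra_simps)
  qed
  from this[of m "eg_rate M m"] have
    "(\<Sum>k=1..m. g k * p k)
      \<le> - eg_potential (eg_rate M m) (\<Sum>k=1..m. g k) + M\<^sup>2 * (\<Sum>k=1..m. eg_rate M k)"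
    using False M by (simp add: eg_rate_pos)
  also have "- eg_potential (eg_rate M m) (\<Sum>k=1..m. g k) \<le> ln 2 / eg_rate M m + a * (\<Sum>k=1..m. g k)"
    using eg_potential_lower[OF eg_rate_pos[OF M] a, of m "\<Sum>k=1..m. g k"] False by simp
  also have "ln 2 / eg_rate M m \<le> M * sqrt (real m)"
  proof -
    have l: "sqrt (ln 2) \<le> 1" using ln_le_minus_one[of 2] by simp
    have "ln 2 / eg_rate M m = sqrt (ln 2) * (M * sqrt (real m))"
      using False M by (simp add: eg_rate_def real_sqrt_divide real_div_sqrt field_simps)
    also have "\<dots> \<le> 1 * (M * sqrt (real m))" using l M by (intro mult_right_mono) auto
    finally show ?thesis by simp
  qed
  also have "M\<^sup>2 * (\<Sum>k=1..m. eg_rate M k) = M * (\<Sum>k=1..m. eg_rate M k * M)"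
    by (simp add: sum_distrib_left power2_eq_square mult_ac)
  also have "\<dots> \<le> M * (2 * sqrt (real m))"
  proof (rule mult_left_mono)
    have "(\<Sum>k=1..m. eg_rate M k * M) \<le> (\<Sum>k=1..m. 1 / sqrt (real k))"
      using M by (intro sum_mono eg_rate_le) auto
    then show "(\<Sum>k=1..m. eg_rate M k * M) \<le> 2 * sqrt (real m)" using sum_inverse_sqrt_le[of m] by simp
  qed (use M in simp)
  finally show ?thesis
    by (simp add: algebra_simps sum_subtractf sum_distrib_left)
qed simp

text \<open>Only interior points have bounded subgradients: at an endpoint of the interval the slope is
  unrestricted on one side. EG predictions are always interior.\<close>

lemma subgradient_abs_le:
  assumes "subgradient_at {0..1} f a v" "M-lipschitz_on {0..1} f" "0 < a" "a < 1"
  shows "\<bar>v\<bar> \<le> M"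
proof -
  have "v * (1 - a) \<le> f 1 - f a" "v * (0 - a) \<le> f 0 - f a"
    using bspec[OF assms(1)[unfolded subgradient_at_def], of 1]
      bspec[OF assms(1)[unfolded subgradient_at_def], of 0] by simp_all
  moreover have "f 1 - f a \<le> M * (1 - a)" "f 0 - f a \<le> M * a"
    using lipschitz_onD[OF assms(2), of 1 a] lipschitz_onD[OF assms(2), of 0 a] assms(3,4)
    by (auto simp: dist_real_def)
  ultimately have "v * (1 - a) \<le> M * (1 - a)" "(- v) * a \<le> M * a" by simp_all
  then have "v \<le> M" "- v \<le> M" using assms(3,4) by (simp_all only: mult_le_cancel_right)
  then show ?thesis by simp
qed

lemma eg_predict_bounds: "0 < eg_predict M g y t" "eg_predict M g y t < 1"
  by (subst eg_predict.simps; simp add: Let_def add_pos_pos)+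

text \<open>Convexity of the loss is used in the form of the subgradient inequality, which bounds the
  regret by that for the linear losses with slopes \<open>loss'\<close>.\<close>

lemma eg_regret:
  assumes M: "M > 0" and y: "\<And>k. k \<in> {1..m} \<Longrightarrow> y k \<in> {0..1}"
    and lip: "\<And>b. b \<in> {0..1} \<Longrightarrow> M-lipschitz_on {0..1} (\<lambda>a. loss a b)"
    and sub: "\<And>a b. a \<in> {0..1} \<Longrightarrow> b \<in> {0..1} \<Longrightarrow> subgradient_at {0..1} (\<lambda>z. loss z b) a (loss' a b)"
    and a: "a \<in> {0..1}"
  shows "(\<Sum>k=1..m. loss (eg_predict M loss' y k) (y k) - loss a (y k)) \<le> 3 * M * sqrt (real m)"
proof -
  define p where "p = eg_predict M loss' y"
  have p: "0 < p k" "p k < 1" for k by (auto simp: p_def eg_predict_bounds)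
  have sub': "subgradient_at {0..1} (\<lambda>z. loss z (y k)) (p k) (loss' (p k) (y k))" if "k \<in> {1..m}" for k
    using sub[of "p k" "y k"] y[OF that] p[of k] by auto
  have "(\<Sum>k=1..m. loss (p k) (y k) - loss a (y k)) \<le> (\<Sum>k=1..m. loss' (p k) (y k) * (p k - a))"
  proof (rule sum_mono)
    fix k assume "k \<in> {1..m}"
    then have "loss (p k) (y k) + loss' (p k) (y k) * (a - p k) \<le> loss a (y k)"
      using sub' a unfolding subgradient_at_def by blast
    then show "loss (p k) (y k) - loss a (y k) \<le> loss' (p k) (y k) * (p k - a)"
      by (simp add: algebra_simps)
  qed
  also have "\<dots> \<le> 3 * M * sqrt (real m)"
  proof (rule eg_linear_regret[OF M _ _ a])
    show "\<bar>loss' (p k) (y k)\<bar> \<le> M" if "k \<in> {1..m}" for k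
      using subgradient_abs_le[OF sub'[OF that] lip[OF y[OF that]]] p by blast
    show "p k = (let w = exp (- eg_rate M k * (\<Sum>s\<in>{1..<k}. loss' (p s) (y s))) in w / (1 + w))" for k
      unfolding p_def by (subst eg_predict.simps) simp
  qed
  finally show ?thesis by (simp add: p_def)
qed

lemma eg_predict_cong:
  assumes "\<And>s. s \<in> {1..<t} \<Longrightarrow> y s = y' s"
  shows "eg_predict M g y t = eg_predict M g y' t"
  using assms
proof (induction t rule: less_induct)
  case (less t)
  then have "(\<Sum>s\<in>{1..<t}. g (eg_predict M g y s) (y s)) = (\<Sum>s\<in>{1..<t}. g (eg_predict M g y' s) (y' s))"
    by (intro sum.cong) auto
  then show ?case by (subst (1 2) eg_predict.simps) simp
qed

section \<open>Regions are half-open boxes\<close>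

text \<open>The upper faces belong to the box only where they lie in the boundary of the unit cube. This is
  what makes the boxes closed under both halvings, with the two halves disjoint.\<close>

definition half_open_box :: "real ^ 'n \<Rightarrow> real ^ 'n \<Rightarrow> (real ^ 'n::finite) set" where
  "half_open_box a b = {x. \<forall>c. a $ c \<le> x $ c \<and> (x $ c < b $ c \<or> x $ c = 1 \<and> b $ c = 1)}"

lemma half_open_box_bounds: "x \<in> half_open_box a b \<Longrightarrow> a $ c \<le> x $ c \<and> x $ c \<le> b $ c"
  unfolding half_open_box_def mem_Collect_eq by (drule spec[of _ c]) auto

definition replace_coord :: "real ^ 'n \<Rightarrow> 'n \<Rightarrow> real \<Rightarrow> real ^ 'n::finite" where
  "replace_coord a c v = (\<chi> j. if j = c then v else a $ j)"

lemma replace_coord_nth [simp]: "replace_coord a c v $ j = (if j = c then v else a $ j)"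
  by (simp add: replace_coord_def)

lemma half_open_box_Inf_Sup:
  fixes a b :: "real ^ 'n::finite"
  assumes ab: "\<And>c. a $ c < b $ c"
  shows "(INF x\<in>half_open_box a b. x $ c) = a $ c"
    and "(SUP x\<in>half_open_box a b. x $ c) = b $ c"
proof -
  have img: "(\<lambda>x. x $ c) ` half_open_box a b = (if b $ c = 1 then {a $ c..1} else {a $ c..<b $ c})"
    (is "?f ` _ = ?I")
  proof (intro equalityI subsetI)
    fix v assume "v \<in> ?I"
    then have "replace_coord a c v \<in> half_open_box a b"
      using ab by (auto simp: half_open_box_def split: if_splits)
    then show "v \<in> ?f ` half_open_box a b" by (rule rev_image_eqI) simp
  next
    fix v assume "v \<in> ?f ` half_open_box a b"
    then obtain x where x: "x \<in> half_open_box a b" "v = x $ c" by blast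
    from x(1) have "a $ c \<le> x $ c \<and> (x $ c < b $ c \<or> x $ c = 1 \<and> b $ c = 1)"
      unfolding half_open_box_def by blast
    then show "v \<in> ?I" using x(2) by auto
  qed
  show "(INF x\<in>half_open_box a b. x $ c) = a $ c" "(SUP x\<in>half_open_box a b. x $ c) = b $ c"
    unfolding img using ab[of c] by auto
qed

lemma all_conj_split_at: "(\<forall>j. P j) \<longleftrightarrow> P c \<and> (\<forall>j. j \<noteq> c \<longrightarrow> P j)"
  by metis

text \<open>Isolating the coordinate \<open>c\<close> makes the halving along \<open>c\<close> a statement about real intervals.\<close>

lemma mem_half_open_box_replace:
  "x \<in> half_open_box (replace_coord a c u) (replace_coord b c v) \<longleftrightarrow>
    u \<le> x $ c \<and> (x $ c < v \<or> x $ c = 1 \<and> v = 1) \<and>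
    (\<forall>j. j \<noteq> c \<longrightarrow> a $ j \<le> x $ j \<and> (x $ j < b $ j \<or> x $ j = 1 \<and> b $ j = 1))"
  unfolding half_open_box_def mem_Collect_eq
  by (subst all_conj_split_at[where c = c]) (simp cong: imp_cong)

lemma replace_coord_same [simp]: "replace_coord a c (a $ c) = a"
  by (simp add: vec_eq_iff)

lemma halves_of_box:
  fixes a b :: "real ^ 'n::finite"
  assumes ab: "\<And>c. a $ c < b $ c" and b: "b $ c \<le> 1"
  defines "m \<equiv> (a $ c + b $ c) / 2"
  shows "lower_half c (half_open_box a b) = half_open_box a (replace_coord b c m)" (is ?L)
    and "upper_half c (half_open_box a b) = half_open_box (replace_coord a c m) b" (is ?U)
    and "half_open_box a (replace_coord b c m) \<union> half_open_box (replace_coord a c m) b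
      = half_open_box a b" (is ?Un)
    and "half_open_box a (replace_coord b c m) \<inter> half_open_box (replace_coord a c m) b = {}" (is ?Int)
proof -
  have m: "a $ c < m" "m < b $ c" using ab[of c] by (auto simp: m_def)
  note mem = mem_half_open_box_replace[of _ a c "a $ c" b m] mem_half_open_box_replace[of _ a c m b "b $ c"]
    mem_half_open_box_replace[of _ a c "a $ c" b "b $ c"]
  note mem = mem[unfolded replace_coord_same]
  show ?L ?U
    unfolding lower_half_def upper_half_def half_open_box_Inf_Sup[OF ab] Let_def m_def[symmetric]
    by (intro set_eqI; use m b in \<open>auto simp: mem split: if_splits\<close>)+
  show ?Un ?Int
    by (intro set_eqI; use m b in \<open>auto simp: mem\<close>)+
qed

text \<open>The number of times the coordinate with index \<open>q\<close> has been cut on the way to a node of depth \<open>h\<close>: the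
  cuts cycle through the \<open>d\<close> coordinates.\<close>

definition halvings :: "nat \<Rightarrow> nat \<Rightarrow> nat \<Rightarrow> nat" where
  "halvings d h q = h div d + (if q < h mod d then 1 else 0)"

lemma halvings_Suc:
  assumes "q < d"
  shows "halvings d (Suc h) q = halvings d h q + (if q = h mod d then 1 else 0)"
proof (cases "Suc (h mod d) = d")
  case True
  then show ?thesis using assms by (auto simp: halvings_def mod_Suc div_Suc)
next
  case False
  then show ?thesis using assms by (auto simp: halvings_def mod_Suc div_Suc)
qed

lemma region_is_box_aux:
  fixes e :: "nat \<Rightarrow> 'n::finite"
  assumes e: "bij_betw e {..<CARD('n)} UNIV"
  shows "\<exists>a b. region e (h, i) = half_open_box a b
    \<and> (\<forall>c. 0 \<le> a $ c \<and> b $ c \<le> 1 \<and> a $ c < b $ c)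
    \<and> (\<forall>q<CARD('n). b $ e q - a $ e q = (1 / 2) ^ halvings CARD('n) h q)"
proof (induction h arbitrary: i)
  case 0
  have "region e (0, i) = half_open_box 0 1"
    by (auto simp: half_open_box_def mem_box_cart order.order_iff_strict)
  then show ?case by (intro exI[of _ 0] exI[of _ 1]) (auto simp: halvings_def)
next
  case (Suc h)
  obtain a b where R: "region e (h, (i + 1) div 2) = half_open_box a b"
    and u: "\<And>c. 0 \<le> a $ c" "\<And>c. b $ c \<le> 1" and ab: "\<And>c. a $ c < b $ c"
    and s: "\<And>q. q < CARD('n) \<Longrightarrow> b $ e q - a $ e q = (1 / 2) ^ halvings CARD('n) h q"
    using Suc.IH[of "(i + 1) div 2"] by (elim exE conjE) metis
  define r where "r = h mod CARD('n)"
  have r: "r < CARD('n)" by (simp add: r_def)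
  have inj: "e q = e r \<longleftrightarrow> q = r" if "q < CARD('n)" for q
    using e r that by (auto simp: bij_betw_def inj_on_def)
  define m where "m = (a $ e r + b $ e r) / 2"
  define a' b' where "a' = (if odd i then a else replace_coord a (e r) m)"
    and "b' = (if odd i then replace_coord b (e r) m else b)"
  have m: "a $ e r < m" "m < b $ e r" using ab[of "e r"] by (auto simp: m_def)
  have "region e (Suc h, i) = half_open_box a' b'"
    unfolding region.simps R a'_def b'_def m_def r_def
    using halves_of_box(1,2)[of a b, OF ab u(2)] by simp
  moreover have "0 \<le> a' $ c \<and> b' $ c \<le> 1 \<and> a' $ c < b' $ c" for c
    using u(1)[of c] u(2)[of c] ab[of c] m by (auto simp: a'_def b'_def)
  moreover have "b' $ e q - a' $ e q = (1 / 2) ^ halvings CARD('n) (Suc h) q" if "q < CARD('n)" for q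
    using s[OF that] inj[OF that] that
    by (auto simp: a'_def b'_def halvings_Suc r_def[symmetric] m_def field_simps)
  ultimately show ?case by (intro exI[of _ a'] exI[of _ b']) simp
qed

lemma region_is_box:
  fixes e :: "nat \<Rightarrow> 'n::finite"
  assumes "bij_betw e {..<CARD('n)} UNIV"
  obtains a b where "region e (h, i) = half_open_box a b"
    "\<And>c. 0 \<le> a $ c" "\<And>c. b $ c \<le> 1" "\<And>c. a $ c < b $ c"
    "\<And>q. q < CARD('n) \<Longrightarrow> b $ e q - a $ e q = (1 / 2) ^ halvings CARD('n) h q"
  using region_is_box_aux[OF assms, of h i] by (elim exE conjE) metis

lemma
  fixes e :: "nat \<Rightarrow> 'n::finite"
  assumes e: "bij_betw e {..<CARD('n)} UNIV" and i: "1 \<le> i"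
  shows region_children_Un: "region e (Suc h, 2 * i - 1) \<union> region e (Suc h, 2 * i) = region e (h, i)"
    and region_children_disjoint: "region e (Suc h, 2 * i - 1) \<inter> region e (Suc h, 2 * i) = {}"
proof -
  obtain a b where R: "region e (h, i) = half_open_box a b"
    and u: "\<And>c. 0 \<le> a $ c" "\<And>c. b $ c \<le> 1" and ab: "\<And>c. a $ c < b $ c"
    and s: "\<And>q. q < CARD('n) \<Longrightarrow> b $ e q - a $ e q = (1 / 2) ^ halvings CARD('n) h q"
    by (rule region_is_box[OF e, of h i]) metis
  show "region e (Suc h, 2 * i - 1) \<union> region e (Suc h, 2 * i) = region e (h, i)"
    "region e (Suc h, 2 * i - 1) \<inter> region e (Suc h, 2 * i) = {}"
    using halves_of_box[of a b, OF ab u(2)] unfolding region_children[OF i] R by simp_all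
qed

lemma region_subset_cube:
  assumes "bij_betw e {..<CARD('n)} UNIV"
  shows "region e (h, i) \<subseteq> cbox 0 (1 :: real ^ 'n::finite)"
proof -
  obtain a b where R: "region e (h, i) = half_open_box a b"
    and u: "\<And>c. 0 \<le> a $ c" "\<And>c. b $ c \<le> 1" and ab: "\<And>c. a $ c < b $ c"
    and s: "\<And>q. q < CARD('n) \<Longrightarrow> b $ e q - a $ e q = (1 / 2) ^ halvings CARD('n) h q"
    by (rule region_is_box[OF assms, of h i]) metis
  show ?thesis
  proof
    fix x assume "x \<in> region e (h, i)"
    then have "a $ c \<le> x $ c \<and> (x $ c < b $ c \<or> x $ c = 1)" for c
      unfolding R half_open_box_def by blast
    then have "0 \<le> x $ c \<and> x $ c \<le> 1" for c using u[of c] by (smt (verit))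
    then show "x \<in> cbox 0 1" by (simp add: mem_box_cart)
  qed
qed

text \<open>After \<open>k d + r\<close> cuts, \<open>r\<close> sides have length \<open>2\<^sup>-\<^sup>k\<^sup>-\<^sup>1\<close> and the other \<open>d - r\<close> have length
  \<open>2\<^sup>-\<^sup>k\<close>. Positivity matters because division by a zero diameter would give \<open>0\<close> in the rule for
  splitting.\<close>

lemma region_diameter:
  fixes e :: "nat \<Rightarrow> 'n::finite"
  assumes e: "bij_betw e {..<CARD('n)} UNIV"
  shows "0 < diameter (region e (h, i))"
    and "(diameter (region e (h, i)))\<^sup>2
      \<le> (1 / 4) ^ (h div CARD('n)) * (real CARD('n) - 3 / 4 * real (h mod CARD('n)))"
proof -
  let ?d = "CARD('n)"
  obtain a b where R: "region e (h, i) = half_open_box a b"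
    and u: "\<And>c. 0 \<le> a $ c" "\<And>c. b $ c \<le> 1" and ab: "\<And>c. a $ c < b $ c"
    and s: "\<And>q. q < CARD('n) \<Longrightarrow> b $ e q - a $ e q = (1 / 2) ^ halvings CARD('n) h q"
    by (rule region_is_box[OF e, of h i]) metis
  have bdd: "bounded (region e (h, i))"
    using region_subset_cube[OF e] bounded_cbox bounded_subset by blast
  define p where "p = (\<chi> c. (a $ c + b $ c) / 2)"
  have "p \<in> region e (h, i)" "a \<in> region e (h, i)" using ab by (auto simp: R half_open_box_def p_def field_simps less_imp_le)
  moreover have "a $ undefined \<noteq> p $ undefined" using ab[of undefined] by (simp add: p_def)
  then have "a \<noteq> p" by auto
  ultimately show "0 < diameter (region e (h, i))"
    using diameter_bounded_bound[OF bdd, of a p] zero_less_dist_iff[of a p] by linarith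
  define D where "D = (\<Sum>q<?d. ((1 / 2) ^ halvings ?d h q)\<^sup>2 :: real)"
  have "diameter (region e (h, i)) \<le> sqrt D"
  proof (rule diameter_le)
    show "region e (h, i) \<noteq> {} \<or> 0 \<le> sqrt D" by (simp add: D_def sum_nonneg)
    fix x y assume "x \<in> region e (h, i)" "y \<in> region e (h, i)"
    then have "a $ c \<le> x $ c \<and> x $ c \<le> b $ c \<and> a $ c \<le> y $ c \<and> y $ c \<le> b $ c" for c
      unfolding R by (blast dest: half_open_box_bounds)
    then have "\<bar>x $ c - y $ c\<bar> \<le> b $ c - a $ c" for c
      unfolding abs_le_iff by (smt (verit))
    then have "(\<bar>x $ c - y $ c\<bar>)\<^sup>2 \<le> (b $ c - a $ c)\<^sup>2" for c by (intro power_mono) auto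
    then have "(\<Sum>c\<in>UNIV. (x $ c - y $ c)\<^sup>2) \<le> (\<Sum>c\<in>UNIV. (b $ c - a $ c)\<^sup>2)"
      by (intro sum_mono) simp
    also have "\<dots> = (\<Sum>q<?d. (b $ e q - a $ e q)\<^sup>2)"
      by (rule sum.reindex_bij_betw[OF e, symmetric])
    also have "\<dots> = D" unfolding D_def using s by (intro sum.cong) auto
    finally show "norm (x - y) \<le> sqrt D" by (simp add: norm_vec_def L2_set_def)
  qed
  then have "(diameter (region e (h, i)))\<^sup>2 \<le> (sqrt D)\<^sup>2"
    using diameter_ge_0[OF bdd] by (intro power_mono)
  also have "(sqrt D)\<^sup>2 = D" by (simp add: D_def sum_nonneg)
  also have "D = (1 / 4) ^ (h div ?d) * (\<Sum>q<?d. if q < h mod ?d then 1 / 4 else 1)"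
    unfolding D_def sum_distrib_left
    by (intro sum.cong refl) (auto simp: halvings_def power_mult[symmetric] power_mult_distrib[symmetric] power2_eq_square)
  also have "(\<Sum>q<?d. if q < h mod ?d then 1 / 4 else 1) = (real ?d - 3 / 4 * real (h mod ?d))"
  proof -
    have r: "h mod ?d < ?d" by simp
    have "(\<Sum>q<?d. if q < h mod ?d then 1 / 4 else (1::real))
       = (\<Sum>q<?d. 1 - 3 / 4 * (if q < h mod ?d then 1 else 0))" by (intro sum.cong) auto
    also have "\<dots> = real ?d - 3 / 4 * (\<Sum>q<?d. if q \<in> {..<h mod ?d} then 1 else 0)"
      by (simp add: sum_subtractf sum_distrib_left)
    also have "(\<Sum>q<?d. if q \<in> {..<h mod ?d} then 1 else (0::real)) = real (card ({..<?d} \<inter> {..<h mod ?d}))"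
      by (subst sum.inter_restrict[symmetric]) auto
    also have "{..<?d} \<inter> {..<h mod ?d} = {..<h mod ?d}" using order_less_trans[OF _ r] by auto
    finally show ?thesis by simp
  qed
  finally show "(diameter (region e (h, i)))\<^sup>2
      \<le> (1 / 4) ^ (h div ?d) * (real ?d - 3 / 4 * real (h mod ?d))" .
qed

section \<open>The binary tree and its leaves\<close>

text \<open>The facts about boxes above describe the regions well enough; unfolding the recursion over the
  depth any further would only make simplification blow up.\<close>

declare region.simps(2) [simp del]

text \<open>The trees the strategy can reach, without reference to the data that triggers the splits.\<close>

inductive split_tree :: "(nat \<times> nat) set \<Rightarrow> bool" where
  root: "split_tree {(0, 1)}"
| split: "split_tree \<T> \<Longrightarrow> n \<in> leaves \<T> \<Longrightarrow> split_tree (\<T> \<union> children n)"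

lemma split_tree_index: "split_tree \<T> \<Longrightarrow> (h, i) \<in> \<T> \<Longrightarrow> 1 \<le> i \<and> i \<le> 2 ^ h"
proof (induction arbitrary: h i rule: split_tree.induct)
  case (split \<T> n)
  obtain h' i' where n: "n = (h', i')" by (cases n)
  have "1 \<le> i' \<and> i' \<le> 2 ^ h'" using split by (auto simp: n leaves_def)
  then show ?case using split.IH[of h i] split.prems by (auto simp: n children_def)
qed auto

lemma childE:
  assumes "m \<in> children (h, i)" "1 \<le> i"
  obtains j where "m = (Suc h, j)" "(j + 1) div 2 = i" "1 \<le> j"
  using assms by (auto simp: children_def)

text \<open>Closure under parents excludes grandchildren of a leaf, so that new children are again leaves.\<close>

lemma split_tree_parent: "split_tree \<T> \<Longrightarrow> (Suc h, j) \<in> \<T> \<Longrightarrow> (h, (j + 1) div 2) \<in> \<T>"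
proof (induction arbitrary: h j rule: split_tree.induct)
  case (split \<T> n)
  obtain h' i' where n: "n = (h', i')" by (cases n)
  have nT: "n \<in> \<T>" using split by (simp add: leaves_def)
  then have "1 \<le> i'" using split_tree_index[OF split.hyps(1)] by (simp add: n)
  show ?case
  proof (cases "(Suc h, j) \<in> \<T>")
    case True
    then show ?thesis using split.IH[of h j] by simp
  next
    case False
    then have "(Suc h, j) \<in> children (h', i')" using split.prems by (simp add: n)
    then have "(h, (j + 1) div 2) = n" by (rule childE) (use \<open>1 \<le> i'\<close> n in simp_all)
    then show ?thesis using nT by simp
  qed
qed simp

lemma finite_children: "finite (children n)"
  by (cases n) (simp add: children_def)

lemma split_tree_finite: "split_tree \<T> \<Longrightarrow> finite \<T>"
  by (induction rule: split_tree.induct) (auto simp: finite_children)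

lemma leaves_split:
  assumes "split_tree \<T>" "n \<in> leaves \<T>"
  shows "leaves (\<T> \<union> children n) = leaves \<T> - {n} \<union> children n"
proof -
  obtain h i where n: "n = (h, i)" by (cases n)
  have nT: "n \<in> \<T>" and ch: "children n \<inter> \<T> = {}" using assms(2) by (simp_all add: leaves_def)
  have i: "1 \<le> i" using split_tree_index[OF assms(1)] nT by (simp add: n)
  have disj: "children m \<inter> children n = {}" if m: "m \<in> \<T>" "m \<noteq> n" for m
  proof (rule ccontr)
    obtain h' i' where m': "m = (h', i')" by (cases m)
    have i': "1 \<le> i'" using split_tree_index[OF assms(1)] m by (simp add: m')
    assume "children m \<inter> children n \<noteq> {}"
    then obtain c where c: "c \<in> children (h', i')" "c \<in> children (h, i)" by (auto simp: n m')
    obtain j where "c = (Suc h', j)" "(j + 1) div 2 = i'" using c(1) i' by (rule childE)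
    moreover obtain j where "c = (Suc h, j)" "(j + 1) div 2 = i" using c(2) i by (rule childE)
    ultimately show False using m by (simp add: n m')
  qed
  have new: "children m \<inter> (\<T> \<union> children n) = {}" if m: "m \<in> children n" for m
  proof -
    obtain j where j: "m = (Suc h, j)" "1 \<le> j" using m[unfolded n] i by (rule childE)
    have mT: "m \<notin> \<T>" using ch m by blast
    have "children m \<inter> \<T> = {}"
    proof (rule ccontr)
      assume "children m \<inter> \<T> \<noteq> {}"
      then obtain c where c: "c \<in> children (Suc h, j)" "c \<in> \<T>" by (auto simp: j(1))
      obtain k where "c = (Suc (Suc h), k)" "(k + 1) div 2 = j" using c(1) j(2) by (rule childE)
      then have "m \<in> \<T>" using split_tree_parent[OF assms(1), of "Suc h" k] c(2) by (simp add: j(1))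
      then show False using mT by simp
    qed
    then show ?thesis by (auto simp: j(1) n children_def)
  qed
  have ne: "children n \<noteq> {}" by (simp add: n children_def)
  show ?thesis
  proof (rule set_eqI)
    fix m
    consider "m = n" | "m \<in> children n" | "m \<in> \<T>" "m \<noteq> n" | "m \<notin> \<T> \<union> children n" by blast
    then show "m \<in> leaves (\<T> \<union> children n) \<longleftrightarrow> m \<in> leaves \<T> - {n} \<union> children n"
    proof cases
      case 1
      then show ?thesis using ch ne nT by (auto simp: leaves_def)
    next
      case 2
      then show ?thesis using new by (simp add: leaves_def)
    next
      case 3
      then have "m \<in> children n \<longleftrightarrow> False" using ch by blast
      then show ?thesis using 3 disj[of m] by (simp add: leaves_def Int_Un_distrib)
    next
      case 4
      then show ?thesis by (auto simp: leaves_def)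
    qed
  qed
qed

text \<open>Splitting a leaf replaces its region by two disjoint ones with the same union, so the leaves
  always partition the cube. Hence the definite description in \<open>nested_leaf\<close> is meaningful.\<close>

lemma split_tree_unique_leaf:
  fixes e :: "nat \<Rightarrow> 'n::finite"
  assumes e: "bij_betw e {..<CARD('n)} UNIV" and x: "x \<in> cbox 0 1"
  shows "split_tree \<T> \<Longrightarrow> \<exists>!n. n \<in> leaves \<T> \<and> x \<in> region e n"
proof (induction rule: split_tree.induct)
  case root
  show ?case by (rule ex1I[of _ "(0, 1)"]) (use x in \<open>auto simp: leaves_def children_def\<close>)
next
  case (split \<T> n)
  obtain h i where n: "n = (h, i)" by (cases n)
  have "n \<in> \<T>" using split by (simp add: leaves_def)
  then have i: "1 \<le> i" using split_tree_index[OF split.hyps(1)] by (auto simp: n)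
  obtain m where m: "m \<in> leaves \<T>" "x \<in> region e m"
    and uniq: "\<And>k. k \<in> leaves \<T> \<Longrightarrow> x \<in> region e k \<Longrightarrow> k = m" using split.IH by blast
  note Un = region_children_Un[OF e i, of h] and Int = region_children_disjoint[OF e i, of h]
  have sub: "region e c \<subseteq> region e n" if "c \<in> children n" for c
    using that Un unfolding n children_def prod.case by blast
  show ?case unfolding leaves_split[OF split.hyps]
  proof (cases "m = n")
    case True
    then have "x \<in> region e (Suc h, 2 * i - 1) \<union> region e (Suc h, 2 * i)" using m(2) Un by (simp only: True n)
    then obtain c where c: "c \<in> children n" "x \<in> region e c" unfolding n children_def prod.case by blast
    have c': "k = c" if "k \<in> children n" "x \<in> region e k" for k
      using that c Int unfolding n children_def prod.case by blast
    show "\<exists>!k. k \<in> leaves \<T> - {n} \<union> children n \<and> x \<in> region e k"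
    proof (rule ex1I[of _ c])
      show "c \<in> leaves \<T> - {n} \<union> children n \<and> x \<in> region e c" using c by simp
      fix k assume "k \<in> leaves \<T> - {n} \<union> children n \<and> x \<in> region e k"
      then show "k = c" using c' uniq True by blast
    qed
  next
    case False
    then have "x \<notin> region e n" using uniq[OF split.hyps(2)] by metis
    then show "\<exists>!k. k \<in> leaves \<T> - {n} \<union> children n \<and> x \<in> region e k"
    proof (intro ex1I[of _ m])
      show "m \<in> leaves \<T> - {n} \<union> children n \<and> x \<in> region e m" using m False by simp
      fix k assume k: "k \<in> leaves \<T> - {n} \<union> children n \<and> x \<in> region e k"
      then have "k \<notin> children n" using sub[of k] \<open>x \<notin> region e n\<close> by blast
      then show "k = m" using k uniq by blast
    qed
  qed
qed

definition visits :: "(nat \<Rightarrow> 'n) \<Rightarrow> (nat \<Rightarrow> real ^ 'n::finite) \<Rightarrow> nat \<times> nat \<Rightarrow> nat \<Rightarrow> nat set" where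
  "visits e x n t = {s \<in> {1..t}. nested_leaf e x s = n}"

lemma finite_visits [simp]: "finite (visits e x n t)"
  by (simp add: visits_def)

definition expands_at :: "(nat \<Rightarrow> 'n) \<Rightarrow> (nat \<Rightarrow> real ^ 'n::finite) \<Rightarrow> nat \<Rightarrow> bool" where
  "expands_at e x t \<longleftrightarrow> real (card (visits e x (nested_leaf e x t) t)) + 1
    \<ge> 1 / (diameter (region e (nested_leaf e x t)))\<^sup>2"

lemma nested_tree_step:
  assumes "1 \<le> t"
  shows "nested_tree e x (Suc t) = (if expands_at e x t
    then nested_tree e x t \<union> children (nested_leaf e x t) else nested_tree e x t)"
proof -
  have "length (filter (\<lambda>s. nested_leaf e x s = nested_leaf e x t) [1..<Suc t])
      = card (set (filter (\<lambda>s. nested_leaf e x s = nested_leaf e x t) [1..<Suc t]))"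
    by (rule distinct_card[symmetric]) simp
  also have "set (filter (\<lambda>s. nested_leaf e x s = nested_leaf e x t) [1..<Suc t])
      = visits e x (nested_leaf e x t) t"
    by (auto simp: visits_def)
  finally show ?thesis using assms
    by (subst nested_tree.simps(2)) (simp add: expands_at_def del: upt_Suc)
qed

lemma nested_tree_1: "nested_tree e x (Suc 0) = {(0, 1)}"
  by (simp add: nested_tree.simps)

lemma nested_tree_mono: "s \<le> t \<Longrightarrow> nested_tree e x s \<subseteq> nested_tree e x t"
proof (rule lift_Suc_mono_le[of "nested_tree e x"])
  show "nested_tree e x k \<subseteq> nested_tree e x (Suc k)" for k
    by (cases "k = 0") (simp add: nested_tree.simps, subst nested_tree_step, auto)
qed

lemma
  fixes e :: "nat \<Rightarrow> 'n::finite" and x :: "nat \<Rightarrow> real ^ 'n"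
  assumes e: "bij_betw e {..<CARD('n)} UNIV" and x: "\<And>t. t \<in> {1..T} \<Longrightarrow> x t \<in> cbox 0 1"
    and t: "t \<in> {1..T}"
  shows nested_tree_split_tree: "split_tree (nested_tree e x t)"
    and nested_leaf_in_leaves: "nested_leaf e x t \<in> leaves (nested_tree e x t)"
    and in_region_nested_leaf: "x t \<in> region e (nested_leaf e x t)"
proof -
  have leaf: "nested_leaf e x s \<in> leaves (nested_tree e x s) \<and> x s \<in> region e (nested_leaf e x s)"
    if "split_tree (nested_tree e x s)" "s \<in> {1..T}" for s
    using theI'[OF split_tree_unique_leaf[OF e x[OF that(2)] that(1)]]
    by (simp add: nested_leaf.simps[of e x s])
  have tree: "s \<in> {1..T} \<Longrightarrow> split_tree (nested_tree e x s)" for s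
  proof (induction s)
    case (Suc s)
    show ?case
    proof (cases "s = 0")
      case True
      then show ?thesis using split_tree.root by (simp add: nested_tree_1)
    next
      case False
      then have "split_tree (nested_tree e x s)" using Suc by simp
      then show ?thesis using leaf[of s] False Suc.prems
        by (auto simp: nested_tree_step intro: split_tree.split)
    qed
  qed simp
  show "split_tree (nested_tree e x t)" "nested_leaf e x t \<in> leaves (nested_tree e x t)"
    "x t \<in> region e (nested_leaf e x t)"
    using tree leaf t by blast+
qed

text \<open>A node is not split after its last use but one, since otherwise it would not be a leaf at its last use.
  That the splitting condition failed at that earlier step reads \<open>(m - 1) + 1 < diam\<^sup>-\<^sup>2\<close>. For \<open>m = 1\<close> there is no such step and
  the bound can fail: the root region has diameter \<open>sqrt d\<close>.\<close>

lemma visits_less_inverse_diameter: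
  fixes e :: "nat \<Rightarrow> 'n::finite" and x :: "nat \<Rightarrow> real ^ 'n"
  assumes e: "bij_betw e {..<CARD('n)} UNIV" and x: "\<And>t. t \<in> {1..T} \<Longrightarrow> x t \<in> cbox 0 1"
    and two: "2 \<le> card (visits e x n T)"
  shows "real (card (visits e x n T)) < 1 / (diameter (region e n))\<^sup>2"
proof -
  define S where "S = visits e x n T"
  define t where "t = Max S"
  have fin: "finite S" and ne: "S \<noteq> {}" using two by (auto simp: S_def)
  have t: "t \<in> S" using Max_in[OF fin ne] by (simp add: t_def)
  define S' where "S' = S - {t}"
  define s where "s = Max S'"
  have card: "card S' = card S - 1" using t by (simp add: S'_def)
  then have "S' \<noteq> {}" using two by (auto simp: S_def simp del: card_Diff_singleton)
  moreover have "finite S'" using fin by (simp add: S'_def)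
  ultimately have s: "s \<in> S'" by (simp add: s_def)
  have "s < t" using s Max_ge[OF fin, of s] by (auto simp: S'_def t_def)
  have S': "S' = visits e x n s"
  proof
    show "S' \<subseteq> visits e x n s"
      using Max_ge[of S'] fin by (auto simp: s_def S'_def S_def visits_def)
    show "visits e x n s \<subseteq> S'"
      using \<open>s < t\<close> t by (auto simp: S'_def S_def visits_def)
  qed
  have sT: "s \<in> {1..T}" "nested_leaf e x s = n" and tT: "t \<in> {1..T}" "nested_leaf e x t = n"
    using s t by (auto simp: S'_def S_def visits_def)
  have "\<not> expands_at e x s"
  proof
    assume "expands_at e x s"
    then have "children n \<subseteq> nested_tree e x (Suc s)" using sT by (simp add: nested_tree_step)
    also have "\<dots> \<subseteq> nested_tree e x t" using \<open>s < t\<close> by (intro nested_tree_mono) simp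
    finally have "children n \<subseteq> nested_tree e x t" .
    moreover have "children n \<inter> nested_tree e x t = {}"
      using nested_leaf_in_leaves[where x = x and T = T, OF e x tT(1)] tT(2) by (simp add: leaves_def)
    ultimately have "children n = {}" by blast
    then show False by (cases n) (simp add: children_def)
  qed
  then have "real (card S') + 1 < 1 / (diameter (region e n))\<^sup>2"
    by (simp add: expands_at_def sT S')
  then show ?thesis using card two by (simp add: S_def)
qed

text \<open>The nodes that have been split by the beginning of step \<open>t\<close>.\<close>

definition inner_nodes :: "(nat \<Rightarrow> 'n) \<Rightarrow> (nat \<Rightarrow> real ^ 'n::finite) \<Rightarrow> nat \<Rightarrow> (nat \<times> nat) set" where
  "inner_nodes e x t = nested_leaf e x ` {s \<in> {1..<t}. expands_at e x s}"

lemma card_nested_tree_le: "card (nested_tree e x t) \<le> 1 + 2 * card (inner_nodes e x t)"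
proof -
  have fin: "finite (inner_nodes e x t)" by (simp add: inner_nodes_def)
  have sub: "nested_tree e x t \<subseteq> insert (0, 1) (\<Union> (children ` inner_nodes e x t))"
  proof (induction t)
    case (Suc t)
    have "inner_nodes e x t \<subseteq> inner_nodes e x (Suc t)" by (auto simp: inner_nodes_def)
    moreover have "nested_leaf e x t \<in> inner_nodes e x (Suc t)" if "1 \<le> t" "expands_at e x t"
      using that by (auto simp: inner_nodes_def)
    ultimately show ?case using Suc
      by (cases "t = 0") (auto simp: nested_tree_1 nested_tree_step split: if_splits)
  qed (simp add: nested_tree.simps)
  have "card (nested_tree e x t) \<le> card (insert (0, 1) (\<Union> (children ` inner_nodes e x t)))"
    using fin finite_children by (intro card_mono sub) auto
  also have "\<dots> \<le> 1 + card (\<Union> (children ` inner_nodes e x t))"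
    by (simp add: card_insert_le_m1 card_insert_if finite_children fin)
  also have "card (\<Union> (children ` inner_nodes e x t)) \<le> (\<Sum>n\<in>inner_nodes e x t. card (children n))"
    by (rule card_UN_le[OF fin])
  also have "\<dots> \<le> (\<Sum>n\<in>inner_nodes e x t. 2)"
    by (intro sum_mono) (auto simp: children_def card_insert_if)
  finally show ?thesis by simp
qed

lemma sum_card_visits_le: "finite A \<Longrightarrow> (\<Sum>n\<in>A. card (visits e x n t)) \<le> t"
proof -
  assume A: "finite A"
  have "(\<Sum>n\<in>A. card (visits e x n t)) = card (\<Union>n\<in>A. visits e x n t)"
    by (rule card_UN_disjoint[symmetric]) (auto simp: A visits_def)
  also have "\<dots> \<le> card {1..t}" by (rule card_mono) (auto simp: visits_def)
  finally show ?thesis by simp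
qed

text \<open>A split node satisfies both \<open>m \<ge> 1\<close> and \<open>m + 1 \<ge> diam\<^sup>-\<^sup>2\<close>; adding these gives the bound.\<close>

lemma inner_node_visits:
  fixes e :: "nat \<Rightarrow> 'n::finite" and x :: "nat \<Rightarrow> real ^ 'n"
  assumes n: "n \<in> inner_nodes e x t"
  shows "1 / (2 * (diameter (region e n))\<^sup>2) \<le> real (card (visits e x n t))"
proof -
  obtain s where s: "s \<in> {1..<t}" "expands_at e x s" "n = nested_leaf e x s"
    using n by (auto simp: inner_nodes_def)
  have "s \<in> visits e x n s" using s by (auto simp: visits_def)
  then have "1 \<le> card (visits e x n s)" by (auto simp: Suc_le_eq card_gt_0_iff)
  moreover have "1 / (diameter (region e n))\<^sup>2 \<le> real (card (visits e x n s)) + 1"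
    using s by (simp add: expands_at_def)
  moreover have "card (visits e x n s) \<le> card (visits e x n t)"
    using s by (intro card_mono) (auto simp: visits_def)
  ultimately show ?thesis by simp
qed

section \<open>The number of nodes\<close>

lemma two_powr_le_chord:
  fixes s :: real
  assumes "0 \<le> s" "s \<le> 1"
  shows "2 powr s \<le> 1 + s"
  using convex_onD[OF exp_convex assms, of 0 "ln 2"] assms by (simp add: powr_def algebra_simps)

text \<open>The squared diameter is at most \<open>d 4\<^sup>-\<^sup>k (1 - 3 u / 4)\<close> with \<open>u = r / d\<close>, whereas
  the interpolation \<open>d 4\<^sup>-\<^sup>h\<^sup>/\<^sup>d\<close> equals \<open>d 4\<^sup>-\<^sup>k 4\<^sup>-\<^sup>u\<close>, which is smaller
  for \<open>0 < u < 1\<close> by convexity. The loss is a factor below \<open>3 / 2\<close>, and it occurs only for \<open>d \<ge> 2\<close>. There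
  \<open>1 + 2 / d \<le> 2\<close>, and for \<open>d = 1\<close> there is no loss and \<open>1 + 2 / d = 3\<close>. So in both cases
  the product of the two factors is at most \<open>3\<close>. The factor \<open>1 + 2 / d\<close> is the one that arises from summing powers with
  exponent \<open>2 / d\<close>.\<close>

lemma diameter_le_powr:
  fixes e :: "nat \<Rightarrow> 'n::finite"
  assumes e: "bij_betw e {..<CARD('n)} UNIV"
  shows "(diameter (region e (h, i)))\<^sup>2 * (1 + 2 / real CARD('n)) * (2 ^ h) powr (2 / real CARD('n))
    \<le> 3 * real CARD('n)"
proof -
  define d where "d = real CARD('n)"
  define k r where "k = h div CARD('n)" and "r = h mod CARD('n)"
  define u where "u = real r / d"
  have d: "1 \<le> d" using zero_less_card_finite[where 'a = 'n] unfolding d_def by linarith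
  have "r < CARD('n)" by (simp add: r_def)
  then have u: "0 \<le> u" "u \<le> 1" using d by (auto simp: u_def d_def)
  have "real h = real k * d + real r"
    unfolding k_def r_def d_def by (metis div_mult_mod_eq of_nat_add of_nat_mult)
  then have hd: "real h * (2 / d) = 2 * real k + 2 * u" using d by (simp add: u_def field_simps)
  have "(2 ^ h) powr (2 / d) = 2 powr (real h * (2 / d))"
    by (simp add: powr_realpow[symmetric] powr_powr)
  also have "\<dots> = 2 powr real (2 * k) * 2 powr (2 * u)" unfolding hd powr_add by simp
  also have "2 powr real (2 * k) = (4::real) ^ k" by (subst powr_realpow) (auto simp: power_mult)
  finally have p: "(2 ^ h) powr (2 / d) = 4 ^ k * 2 powr (2 * u)" .
  have "d - 3 / 4 * real r = d * (1 - 3 / 4 * u)" using d by (simp add: u_def field_simps)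
  then have "(diameter (region e (h, i)))\<^sup>2 \<le> (1 / 4) ^ k * (d * (1 - 3 / 4 * u))"
    using region_diameter(2)[OF e, of h i] by (simp add: k_def r_def d_def)
  then have "(diameter (region e (h, i)))\<^sup>2 * ((1 + 2 / d) * (2 ^ h) powr (2 / d))
      \<le> (1 / 4) ^ k * (d * (1 - 3 / 4 * u)) * ((1 + 2 / d) * (2 ^ h) powr (2 / d))"
    using d by (intro mult_right_mono) auto
  also have "\<dots> = (1 / 4 * 4) ^ k * (d * ((1 + 2 / d) * ((1 - 3 / 4 * u) * 2 powr (2 * u))))"
    unfolding p by (simp add: power_mult_distrib[symmetric] mult_ac)
  also have "\<dots> = d * ((1 + 2 / d) * ((1 - 3 / 4 * u) * 2 powr (2 * u)))" by simp
  also have "\<dots> \<le> d * 3"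
  proof (rule mult_left_mono)
    show "(1 + 2 / d) * ((1 - 3 / 4 * u) * 2 powr (2 * u)) \<le> 3"
    proof (cases "CARD('n) = 1")
      case True
      then show ?thesis by (simp add: u_def r_def d_def)
    next
      case False
      then have "2 \<le> CARD('n)" using zero_less_card_finite[where 'a = 'n] by linarith
      then have "1 + 2 / d \<le> 2" by (simp add: d_def)
      moreover have "(1 - 3 / 4 * u) * 2 powr (2 * u) \<le> 3 / 2"
      proof (cases "2 * u \<le> 1")
        case True
        \<comment> \<open>The convex function \<open>4\<^sup>u\<close> lies below its chords on \<open>[0, 1/2]\<close> and on \<open>[1/2, 1]\<close>.\<close>
        have "(1 - 3 / 4 * u) * 2 powr (2 * u) \<le> (1 - 3 / 4 * u) * (1 + 2 * u)"
          using two_powr_le_chord[of "2 * u"] True u by (intro mult_left_mono) auto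
        also have "\<dots> = 3 / 2 - (3 / 2 * (u - 5 / 12)\<^sup>2 + 23 / 96)" by (simp add: power2_eq_square field_simps)
        also have "\<dots> \<le> 3 / 2" using zero_le_power2[of "u - 5 / 12"] by linarith
        finally show ?thesis .
      next
        case False
        have "2 powr (2 * u) = 2 powr (1 + (2 * u - 1))" by simp
        also have "\<dots> = 2 * 2 powr (2 * u - 1)" by (subst powr_add) simp
        also have "\<dots> \<le> 4 * u" using two_powr_le_chord[of "2 * u - 1"] False u by simp
        finally have "(1 - 3 / 4 * u) * 2 powr (2 * u) \<le> (1 - 3 / 4 * u) * (4 * u)"
          using u by (intro mult_left_mono) auto
        also have "\<dots> = 3 / 2 - (3 * (u - 2 / 3)\<^sup>2 + 1 / 6)" by (simp add: power2_eq_square field_simps)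
        also have "\<dots> \<le> 3 / 2" using zero_le_power2[of "u - 2 / 3"] by linarith
        finally show ?thesis .
      qed
      ultimately have "(1 + 2 / d) * ((1 - 3 / 4 * u) * 2 powr (2 * u)) \<le> 2 * (3 / 2)"
        using u d by (intro mult_mono) auto
      then show ?thesis by simp
    qed
  qed (use d in simp)
  finally show ?thesis by (simp add: d_def mult_ac)
qed

lemma powr_Suc_diff_le:
  fixes p :: real
  assumes p: "0 \<le> p"
  shows "real (Suc n) powr (1 + p) - real n powr (1 + p) \<le> (1 + p) * real (Suc n) powr p"
proof (cases "n = 0")
  case False
  have "\<exists>z>real n. z < real (Suc n) \<and> real (Suc n) powr (1 + p) - real n powr (1 + p)
      = (real (Suc n) - real n) * ((1 + p) * z powr p)"
  proof (rule MVT2)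
    fix z assume "real n \<le> z"
    then show "((\<lambda>z. z powr (1 + p)) has_real_derivative (1 + p) * z powr p) (at z)"
      using False by (auto intro!: derivative_eq_intros simp: powr_diff)
  qed simp
  then obtain z where z: "real n < z" "z < real (Suc n)"
    "real (Suc n) powr (1 + p) - real n powr (1 + p) = (1 + p) * z powr p" by auto
  then show ?thesis using p by (auto intro!: mult_left_mono powr_mono2)
qed (use p in simp)

text \<open>Among all sets of \<open>n\<close> positive integers, \<open>{1..n}\<close> has the smallest sum of powers, and for this set
  the sum dominates the integral of the power function. Both facts are merged into one induction on the largest element.\<close>

lemma sum_powr_ge:
  fixes p :: real
  assumes "finite V" "V \<subseteq> {1..}" and p: "0 \<le> p"
  shows "real (card V) powr (1 + p) \<le> (1 + p) * (\<Sum>v\<in>V. real v powr p)"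
  using assms(1,2)
proof (induction rule: finite_linorder_max_induct)
  case (insert b V)
  have "V \<subseteq> {1..<b}" using insert by auto
  then have "card V \<le> card {1..<b}" by (intro card_mono) auto
  moreover have "1 \<le> b" using insert.prems by simp
  ultimately have "Suc (card V) \<le> b" by simp
  then have "(1 + p) * real (Suc (card V)) powr p \<le> (1 + p) * real b powr p"
    using p by (intro mult_left_mono powr_mono2) auto
  then have "real (Suc (card V)) powr (1 + p) \<le> real (card V) powr (1 + p) + (1 + p) * real b powr p"
    using powr_Suc_diff_le[OF p, of "card V"] by linarith
  moreover have "b \<notin> V" using insert by auto
  moreover have "real (card V) powr (1 + p) \<le> (1 + p) * (\<Sum>v\<in>V. real v powr p)"
    using insert by simp
  ultimately show ?case using insert.hyps(1) by (simp add: algebra_simps)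
qed simp

text \<open>The position of a node in the breadth-first enumeration of the infinite binary tree, starting at \<open>1\<close>.\<close>

definition heap_index :: "nat \<times> nat \<Rightarrow> nat" where
  "heap_index n = 2 ^ fst n + snd n - 1"

lemma heap_index_bounds:
  assumes "1 \<le> i" "i \<le> 2 ^ h"
  shows "2 ^ h \<le> heap_index (h, i)" "heap_index (h, i) < 2 ^ Suc h"
  using assms by (auto simp: heap_index_def)

lemma heap_index_inj:
  assumes "1 \<le> i" "i \<le> 2 ^ h" "1 \<le> i'" "i' \<le> 2 ^ h'" "heap_index (h, i) = heap_index (h', i')"
  shows "(h, i) = (h', i')"
proof -
  have "(2::nat) ^ h < 2 ^ Suc h'" "(2::nat) ^ h' < 2 ^ Suc h"
    using heap_index_bounds[of i h] heap_index_bounds[of i' h'] assms by linarith+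
  then have "h < Suc h'" "h' < Suc h" 
    using power_less_imp_less_exp[of "2::nat" h "Suc h'"] power_less_imp_less_exp[of "2::nat" h' "Suc h"]
    by (simp_all del: power_Suc)
  then have "h = h'" by simp
  then show ?thesis using assms by (simp add: heap_index_def)
qed

lemma used_leaves_subset_tree:
  fixes e :: "nat \<Rightarrow> 'n::finite" and x :: "nat \<Rightarrow> real ^ 'n"
  assumes e: "bij_betw e {..<CARD('n)} UNIV" and x: "\<And>t. t \<in> {1..T} \<Longrightarrow> x t \<in> cbox 0 1"
  shows "nested_leaf e x ` {1..T} \<subseteq> nested_tree e x T"
proof
  fix n assume "n \<in> nested_leaf e x ` {1..T}"
  then obtain s where s: "s \<in> {1..T}" "n = nested_leaf e x s" by blast
  then have "n \<in> nested_tree e x s" using nested_leaf_in_leaves[where x = x and T = T, OF e x s(1)] by (simp add: leaves_def)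
  then show "n \<in> nested_tree e x T" using nested_tree_mono[of s T e x] s by auto
qed

text \<open>With \<open>p = 2 / d\<close>, the split node numbered \<open>v\<close> in breadth-first order has depth \<open>h\<close> with \<open>2\<^sup>h > v / 2\<close>,
  hence was used at least \<open>(1 + p) (v / 2)\<^sup>p / (6 d)\<close> times. Summing over the \<open>I\<close> split nodes, the factor \<open>1 + p\<close> cancels
  and \<open>(I / 2)\<^sup>1\<^sup>+\<^sup>p \<le> 3 d T\<close> remains.\<close>

lemma card_inner_nodes_le:
  fixes e :: "nat \<Rightarrow> 'n::finite" and x :: "nat \<Rightarrow> real ^ 'n"
  assumes e: "bij_betw e {..<CARD('n)} UNIV" and x: "\<And>t. t \<in> {1..T} \<Longrightarrow> x t \<in> cbox 0 1"
    and T: "1 \<le> T"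
  shows "real (card (inner_nodes e x T))
    \<le> 2 * (3 * real CARD('n) * real T) powr (real CARD('n) / (real CARD('n) + 2))"
proof -
  define d where "d = real CARD('n)"
  define p where "p = 2 / d"
  define A where "A = inner_nodes e x T"
  have d: "0 < d" by (simp add: d_def)
  have p: "0 \<le> p" using d by (simp add: p_def)
  have fin: "finite A" by (simp add: A_def inner_nodes_def)
  have index: "1 \<le> i \<and> i \<le> 2 ^ h" if "(h, i) \<in> A" for h i
  proof -
    have "A \<subseteq> nested_leaf e x ` {1..T}" by (auto simp: A_def inner_nodes_def)
    then have "A \<subseteq> nested_tree e x T" using used_leaves_subset_tree[where x = x and T = T, OF e x] by blast
    then show ?thesis using split_tree_index[OF nested_tree_split_tree[where x = x and T = T and t = T, OF e x]] that T by auto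
  qed
  have visits: "(1 + p) * (real (heap_index n) / 2) powr p / (6 * d) \<le> real (card (visits e x n T))"
    if n: "n \<in> A" for n
  proof (cases n)
    case (Pair h i)
    have "heap_index n \<le> 2 ^ Suc h"
      using heap_index_bounds(2)[of i h] index[of h i] n unfolding Pair by simp
    then have "real (heap_index n) \<le> real (2 ^ Suc h)" by (simp only: of_nat_le_iff)
    then have "real (heap_index n) / 2 \<le> 2 ^ h" by simp
    then have "(1 + p) * (real (heap_index n) / 2) powr p \<le> (1 + p) * (2 ^ h) powr p"
      using p by (intro mult_left_mono powr_mono2) auto
    then have "(1 + p) * (real (heap_index n) / 2) powr p / (6 * d) \<le> (1 + p) * (2 ^ h) powr p / (6 * d)"
      using d by (intro divide_right_mono) auto
    also have "\<dots> \<le> 1 / (2 * (diameter (region e n))\<^sup>2)"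
      using diameter_le_powr[OF e, of h i] region_diameter(1)[OF e, of h i] d
      by (simp add: Pair p_def d_def field_simps)
    also have "\<dots> \<le> real (card (visits e x n T))"
      using inner_node_visits n by (simp add: A_def)
    finally show ?thesis .
  qed
  have inj: "inj_on heap_index A"
  proof (rule inj_onI)
    fix n n' assume *: "n \<in> A" "n' \<in> A" "heap_index n = heap_index n'"
    obtain h i h' i' where "n = (h, i)" "n' = (h', i')" by fastforce
    with * index[of h i] index[of h' i'] show "n = n'" using heap_index_inj[of i h i' h'] by simp
  qed
  have "real (card A) powr (1 + p) / 2 powr p / (6 * d)
      \<le> (1 + p) * (\<Sum>v\<in>heap_index ` A. real v powr p) / 2 powr p / (6 * d)"
  proof (intro divide_right_mono)
    have "heap_index ` A \<subseteq> {1..}"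
    proof (clarsimp)
      fix h i assume "(h, i) \<in> A"
      then have "2 ^ h \<le> heap_index (h, i)" using heap_index_bounds index by blast
      then show "Suc 0 \<le> heap_index (h, i)" using one_le_power[of "2::nat" h] by linarith
    qed
    from sum_powr_ge[OF _ this p] fin
    show "real (card A) powr (1 + p) \<le> (1 + p) * (\<Sum>v\<in>heap_index ` A. real v powr p)"
      by (simp add: card_image[OF inj])
  qed (use d in auto)
  also have "(\<Sum>v\<in>heap_index ` A. real v powr p) = (\<Sum>n\<in>A. real (heap_index n) powr p)"
    by (simp add: sum.reindex[OF inj])
  also have "(1 + p) * \<dots> / 2 powr p / (6 * d) = (\<Sum>n\<in>A. (1 + p) * (real (heap_index n) / 2) powr p / (6 * d))"
    by (simp add: sum_distrib_left sum_divide_distrib powr_divide)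
  also have "\<dots> \<le> (\<Sum>n\<in>A. real (card (visits e x n T)))" by (intro sum_mono visits)
  also have "\<dots> \<le> real T" using sum_card_visits_le[OF fin, of e x T] by (simp flip: of_nat_sum)
  finally have "real (card A) powr (1 + p) / 2 powr p / (6 * d) \<le> real T" .
  then have "(real (card A) / 2) powr (1 + p) \<le> 3 * d * real T"
    using d by (simp add: powr_divide powr_add field_simps)
  then have "((real (card A) / 2) powr (1 + p)) powr (1 / (1 + p)) \<le> (3 * d * real T) powr (1 / (1 + p))"
    using p by (intro powr_mono2) auto
  moreover have "((real (card A) / 2) powr (1 + p)) powr (1 / (1 + p)) = real (card A) / 2"
    using p by (simp add: powr_powr)
  moreover have "1 / (1 + p) = d / (d + 2)" using d by (simp add: p_def field_simps)
  ultimately have "real (card A) / 2 \<le> (3 * d * real T) powr (d / (d + 2))" by simp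
  then show ?thesis by (simp add: A_def d_def)
qed

lemma sqrt_card_tree_le:
  fixes e :: "nat \<Rightarrow> 'n::finite" and x :: "nat \<Rightarrow> real ^ 'n"
  assumes e: "bij_betw e {..<CARD('n)} UNIV" and x: "\<And>t. t \<in> {1..T} \<Longrightarrow> x t \<in> cbox 0 1"
    and T: "1 \<le> T"
  shows "sqrt (real (card (nested_tree e x T)) * real T) \<le> sqrt (real T)
    + 2 * (3 * real CARD('n)) powr (real CARD('n) / (2 * (real CARD('n) + 2)))
      * real T powr ((real CARD('n) + 1) / (real CARD('n) + 2))"
proof -
  define d where "d = real CARD('n)"
  define I where "I = real (card (inner_nodes e x T))"
  define B where "B = 2 * (3 * d) powr (d / (2 * (d + 2))) * real T powr ((d + 1) / (d + 2))"
  have d: "0 < d" by (simp add: d_def)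
  have sq: "(a powr b)\<^sup>2 = a powr (2 * b)" for a b :: real
    by (simp add: power2_eq_square powr_add[symmetric])
  have half: "2 * (a / (2 * b)) = a / b" "2 * a / (2 * b) = a / b" for a b :: real by simp_all
  have "B\<^sup>2 = 4 * (3 * d) powr (d / (d + 2)) * real T powr (2 * (d + 1) / (d + 2))"
    unfolding B_def power_mult_distrib sq by (simp only: half times_divide_eq_right) simp
  also have "2 * (d + 1) / (d + 2) = 1 + d / (d + 2)" using d by (simp add: field_simps)
  also have "real T powr (1 + d / (d + 2)) = real T * real T powr (d / (d + 2))"
    using T by (simp add: powr_add)
  finally have B2: "B\<^sup>2 = 2 * (2 * (3 * d * real T) powr (d / (d + 2))) * real T"
    using d by (simp add: powr_mult)
  have "real (card (nested_tree e x T)) \<le> real (1 + 2 * card (inner_nodes e x T))"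
    using card_nested_tree_le[of e x T] by (simp only: of_nat_le_iff)
  then have "real (card (nested_tree e x T)) \<le> 1 + 2 * I" by (simp add: I_def)
  then have "real (card (nested_tree e x T)) * real T \<le> (1 + 2 * I) * real T"
    by (intro mult_right_mono) auto
  also have "\<dots> = real T + 2 * I * real T" by (simp add: algebra_simps)
  also have "2 * I * real T \<le> B\<^sup>2"
    unfolding B2 using card_inner_nodes_le[where x = x and T = T, OF e x T] by (intro mult_right_mono mult_left_mono) (auto simp: I_def d_def)
  finally have "sqrt (real (card (nested_tree e x T)) * real T) \<le> sqrt (real T + B\<^sup>2)" by simp
  also have "\<dots> \<le> sqrt (real T) + sqrt (B\<^sup>2)" by (rule sqrt_add_le_add_sqrt) auto
  also have "sqrt (B\<^sup>2) = B" by (simp add: B_def)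
  finally show ?thesis by (simp add: B_def d_def)
qed

section \<open>Regret of the nested strategy\<close>

text \<open>The earlier uses of a leaf, as seen from one of its uses, are a prefix of the list of all its uses.\<close>

lemma filter_upt_prefix:
  assumes "k < length (filter P [1..<Suc T])"
  shows "filter P [1..<filter P [1..<Suc T] ! k] = take k (filter P [1..<Suc T])"
proof -
  define ts where "ts = filter P [1..<Suc T]"
  define t where "t = ts ! k"
  have k: "k < length ts" using assms by (simp add: ts_def)
  then have t: "t \<in> set ts" by (simp add: t_def)
  then have tT: "1 \<le> t" "t \<le> T" "P t" unfolding ts_def by auto
  then have "[1..<Suc T] = [1..<t] @ [t..<Suc T]" by (metis le_Suc_eq upt_add_eq_append le_iff_add)
  also have "[t..<Suc T] = t # [Suc t..<Suc T]" using tT by (simp add: upt_conv_Cons del: upt_Suc)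
  finally have ts: "ts = filter P [1..<t] @ t # filter P [Suc t..<Suc T]"
    using tT by (simp add: ts_def del: upt_Suc)
  have "distinct ts" by (simp add: ts_def)
  moreover have "ts ! length (filter P [1..<t]) = ts ! k" by (subst ts) (simp add: t_def[symmetric])
  moreover have "length (filter P [1..<t]) < length ts" by (subst ts) simp
  ultimately have "length (filter P [1..<t]) = k" using k by (simp add: nth_eq_iff_index_eq)
  then show ?thesis using ts by (metis append_eq_conv_conj ts_def t_def)
qed

text \<open>Consequently the predictions made at one leaf are those of a single EG forecaster run on the
  subsequence of outcomes at that leaf.\<close>

lemma nested_predict_eq_eg:
  assumes n: "ts = filter (\<lambda>s. nested_leaf e x s = n) [1..<Suc T]" and k: "k < length ts"
  shows "nested_predict e M g x y (ts ! k) = eg_predict M g (\<lambda>j. y (ts ! (j - 1))) (Suc k)"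
proof -
  have "ts ! k \<in> set ts" using k by simp
  then have leaf: "nested_leaf e x (ts ! k) = n" by (auto simp: n)
  have "filter (\<lambda>s. nested_leaf e x s = n) [1..<ts ! k] = take k ts"
    using filter_upt_prefix[of k "\<lambda>s. nested_leaf e x s = n" T] k n by simp
  then have "nested_predict e M g x y (ts ! k)
      = eg_predict M g (\<lambda>j. map y (take k ts) ! (j - 1)) (length (map y (take k ts)) + 1)"
    unfolding nested_predict_def leaf by (simp only: Let_def)
  also have "\<dots> = eg_predict M g (\<lambda>j. map y (take k ts) ! (j - 1)) (Suc k)" using k by simp
  also have "\<dots> = eg_predict M g (\<lambda>j. y (ts ! (j - 1))) (Suc k)"
    using k by (intro eg_predict_cong) auto
  finally show ?thesis .
qed

text \<open>The comparison constant is the value of \<open>f\<close> at the first point seen by the leaf. At that step the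
  approximation error is zero, so only \<open>m - 1\<close> errors of size \<open>M L diam\<close> occur; this covers the case \<open>m = 1\<close>,
  in which the diameter may be large.\<close>

lemma leaf_regret:
  fixes e :: "nat \<Rightarrow> 'n::finite" and x :: "nat \<Rightarrow> real ^ 'n"
  assumes e: "bij_betw e {..<CARD('n)} UNIV" and x: "\<And>t. t \<in> {1..T} \<Longrightarrow> x t \<in> cbox 0 1"
    and M: "M > 0" and y: "\<And>t. t \<in> {1..T} \<Longrightarrow> y t \<in> {0..1}"
    and lip: "\<And>b. b \<in> {0..1} \<Longrightarrow> M-lipschitz_on {0..1} (\<lambda>a. loss a b)"
    and sub: "\<And>a b. a \<in> {0..1} \<Longrightarrow> b \<in> {0..1} \<Longrightarrow> subgradient_at {0..1} (\<lambda>z. loss z b) a (loss' a b)"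
    and f: "f \<in> lipschitz_class L" and ne: "visits e x n T \<noteq> {}"
  shows "(\<Sum>t\<in>visits e x n T. loss (nested_predict e M loss' x y t) (y t) - loss (f (x t)) (y t))
    \<le> M * (3 + L) * sqrt (real (card (visits e x n T)))"
proof -
  define S where "S = visits e x n T"
  define m where "m = card S"
  define ts where "ts = filter (\<lambda>s. nested_leaf e x s = n) [1..<Suc T]"
  define p where "p = nested_predict e M loss' x y"
  have fin: "finite S" by (simp add: S_def)
  have setts: "set ts = S" by (auto simp: ts_def S_def visits_def)
  have dist: "distinct ts" by (simp add: ts_def)
  have len: "length ts = m" using distinct_card[OF dist] by (simp add: setts m_def)
  have m: "1 \<le> m" using ne fin by (simp add: m_def S_def Suc_le_eq card_gt_0_iff)
  have reindex: "(\<Sum>t\<in>S. F t) = (\<Sum>k=1..m. F (ts ! (k - 1)))" for F :: "nat \<Rightarrow> real"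
  proof -
    have "bij_betw ((!) ts) {..<m} S" by (rule bij_betw_nth[OF dist]) (simp_all add: len setts)
    from sum.reindex_bij_betw[OF this, of F] show ?thesis by (simp add: sum.atLeast1_atMost_eq)
  qed
  have inS: "t \<in> {1..T}" "x t \<in> region e n" if "t \<in> S" for t
  proof -
    show t: "t \<in> {1..T}" using that by (simp add: S_def visits_def)
    show "x t \<in> region e n"
      using in_region_nested_leaf[where x = x and T = T, OF e x t] that by (simp add: S_def visits_def)
  qed
  define t0 where "t0 = ts ! 0"
  define a where "a = f (x t0)"
  have t0: "t0 \<in> S" using m len unfolding t0_def setts[symmetric] by (intro nth_mem) simp
  have f01: "f (x t) \<in> {0..1}" if "t \<in> S" for t
    using f x[OF inS(1)[OF that]] unfolding lipschitz_class_def by blast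
  have fL: "L-lipschitz_on (cbox 0 1) f" using f by (simp add: lipschitz_class_def)
  then have L: "0 \<le> L" by (rule lipschitz_on_nonneg)
  have a: "a \<in> {0..1}" using f01[OF t0] by (simp add: a_def)
  have "(\<Sum>t\<in>S. loss (p t) (y t) - loss a (y t))
      = (\<Sum>k=1..m. loss (eg_predict M loss' (\<lambda>j. y (ts ! (j - 1))) k) (y (ts ! (k - 1)))
          - loss a (y (ts ! (k - 1))))"
    unfolding reindex
  proof (intro sum.cong refl)
    fix k assume "k \<in> {1..m}"
    then have "k - 1 < length ts" "Suc (k - 1) = k" using len by auto
    then show "loss (p (ts ! (k - 1))) (y (ts ! (k - 1))) - loss a (y (ts ! (k - 1)))
      = loss (eg_predict M loss' (\<lambda>j. y (ts ! (j - 1))) k) (y (ts ! (k - 1))) - loss a (y (ts ! (k - 1)))"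
      using nested_predict_eq_eg[OF ts_def, of "k - 1" M loss' y] by (simp add: p_def)
  qed
  also have "\<dots> \<le> 3 * M * sqrt (real m)"
  proof (rule eg_regret[OF M _ lip sub a])
    fix k assume "k \<in> {1..m}"
    then have "ts ! (k - 1) \<in> S" unfolding setts[symmetric] using len by (intro nth_mem) auto
    then show "y (ts ! (k - 1)) \<in> {0..1}" using y inS(1) by blast
  qed
  finally have eg: "(\<Sum>t\<in>S. loss (p t) (y t) - loss a (y t)) \<le> 3 * M * sqrt (real m)" .
  define D where "D = diameter (region e n)"
  obtain h i where n: "n = (h, i)" by (cases n)
  have bdd: "bounded (region e n)"
    using region_subset_cube[OF e, of h i] bounded_cbox bounded_subset unfolding n by blast
  have D: "0 \<le> D" using diameter_ge_0[OF bdd] by (simp add: D_def)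
  have "(\<Sum>t\<in>S. loss a (y t) - loss (f (x t)) (y t)) = (\<Sum>t\<in>S - {t0}. loss a (y t) - loss (f (x t)) (y t))"
    using sum.remove[OF fin t0, of "\<lambda>t. loss a (y t) - loss (f (x t)) (y t)"] by (simp add: a_def)
  also have "\<dots> \<le> (\<Sum>t\<in>S - {t0}. M * (L * D))"
  proof (rule sum_mono)
    fix t assume "t \<in> S - {t0}"
    then have t: "t \<in> S" by simp
    have "loss a (y t) - loss (f (x t)) (y t) \<le> M * dist a (f (x t))"
      using lipschitz_onD[OF lip[OF y[OF inS(1)[OF t]]] a f01[OF t]] by (simp add: dist_real_def)
    also have "dist a (f (x t)) \<le> L * dist (x t0) (x t)"
      unfolding a_def using lipschitz_onD[OF fL] x inS(1) t t0 by blast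
    also have "dist (x t0) (x t) \<le> D"
      unfolding D_def by (rule diameter_bounded_bound[OF bdd inS(2)[OF t0] inS(2)[OF t]])
    finally show "loss a (y t) - loss (f (x t)) (y t) \<le> M * (L * D)"
      using M L by (simp add: mult_left_mono)
  qed
  also have "\<dots> = M * L * (real (m - 1) * D)" using t0 fin by (simp add: m_def)
  also have "\<dots> \<le> M * L * sqrt (real m)"
  proof (rule mult_left_mono)
    show "real (m - 1) * D \<le> sqrt (real m)"
    proof (cases "2 \<le> m")
      case True
      have "real m < 1 / D\<^sup>2"
        using visits_less_inverse_diameter[where x = x and T = T, OF e x, of n] True
        by (simp add: m_def S_def D_def)
      moreover from this have "0 < D\<^sup>2" using True D by (cases "D = 0") auto
      ultimately have "real m * D\<^sup>2 \<le> 1" by (simp add: field_simps)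
      then have "sqrt (real m * D\<^sup>2) \<le> 1" by simp
      then have *: "sqrt (real m) * D \<le> 1" using D by (simp add: real_sqrt_mult)
      have "real (m - 1) * D \<le> real m * D" using D by (intro mult_right_mono) auto
      also have "\<dots> = sqrt (real m) * (sqrt (real m) * D)" by (simp add: mult.assoc[symmetric])
      also have "\<dots> \<le> sqrt (real m) * 1" by (intro mult_left_mono *) simp
      finally show ?thesis by simp
    qed (use m in simp)
  qed (use M L in simp)
  finally have approx: "(\<Sum>t\<in>S. loss a (y t) - loss (f (x t)) (y t)) \<le> M * L * sqrt (real m)" .
  have "(\<Sum>t\<in>S. loss (p t) (y t) - loss (f (x t)) (y t))
      = (\<Sum>t\<in>S. loss (p t) (y t) - loss a (y t)) + (\<Sum>t\<in>S. loss a (y t) - loss (f (x t)) (y t))"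
    by (simp add: sum_subtractf)
  also have "\<dots> \<le> M * (3 + L) * sqrt (real m)" using eg approx by (simp add: algebra_simps)
  finally show ?thesis by (simp add: S_def m_def p_def)
qed

lemma sum_sqrt_card_visits_le:
  assumes "finite A"
  shows "(\<Sum>n\<in>A. sqrt (real (card (visits e x n T)))) \<le> sqrt (real (card A) * real T)"
proof -
  have "(\<Sum>n\<in>A. 1 * sqrt (real (card (visits e x n T))))\<^sup>2
      \<le> (\<Sum>n\<in>A. 1\<^sup>2) * (\<Sum>n\<in>A. (sqrt (real (card (visits e x n T))))\<^sup>2)"
    by (rule Cauchy_Schwarz_ineq_sum)
  also have "\<dots> = real (card A) * real (\<Sum>n\<in>A. card (visits e x n T))" by simp
  also have "\<dots> \<le> real (card A) * real T"
    using sum_card_visits_le[OF assms] by (intro mult_left_mono) (auto simp flip: of_nat_sum)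
  finally show ?thesis by (simp add: real_le_rsqrt)
qed

lemma nested_regret:
  fixes e :: "nat \<Rightarrow> 'n::finite" and x :: "nat \<Rightarrow> real ^ 'n"
  assumes e: "bij_betw e {..<CARD('n)} UNIV" and x: "\<And>t. t \<in> {1..T} \<Longrightarrow> x t \<in> cbox 0 1"
    and T: "1 \<le> T" and M: "M > 0" and L: "0 \<le> L" and y: "\<And>t. t \<in> {1..T} \<Longrightarrow> y t \<in> {0..1}"
    and lip: "\<And>b. b \<in> {0..1} \<Longrightarrow> M-lipschitz_on {0..1} (\<lambda>a. loss a b)"
    and sub: "\<And>a b. a \<in> {0..1} \<Longrightarrow> b \<in> {0..1} \<Longrightarrow> subgradient_at {0..1} (\<lambda>z. loss z b) a (loss' a b)"
    and f: "f \<in> lipschitz_class L"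
  shows "(\<Sum>t=1..T. loss (nested_predict e M loss' x y t) (y t)) - (\<Sum>t=1..T. loss (f (x t)) (y t))
    \<le> M * (3 + L) * sqrt (real (card (nested_tree e x T)) * real T)"
proof -
  define A where "A = nested_leaf e x ` {1..T}"
  have fin: "finite A" by (simp add: A_def)
  have "(\<Sum>t=1..T. loss (nested_predict e M loss' x y t) (y t)) - (\<Sum>t=1..T. loss (f (x t)) (y t))
      = (\<Sum>t=1..T. loss (nested_predict e M loss' x y t) (y t) - loss (f (x t)) (y t))"
    by (simp add: sum_subtractf)
  also have "\<dots> = (\<Sum>n\<in>A. \<Sum>t\<in>visits e x n T. loss (nested_predict e M loss' x y t) (y t) - loss (f (x t)) (y t))"
    unfolding A_def visits_def by (rule sum.image_gen) simp
  also have "\<dots> \<le> (\<Sum>n\<in>A. M * (3 + L) * sqrt (real (card (visits e x n T))))"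
  proof (rule sum_mono)
    fix n assume "n \<in> A"
    then have "visits e x n T \<noteq> {}" by (auto simp: A_def visits_def)
    then show "(\<Sum>t\<in>visits e x n T. loss (nested_predict e M loss' x y t) (y t) - loss (f (x t)) (y t))
        \<le> M * (3 + L) * sqrt (real (card (visits e x n T)))"
      by (intro leaf_regret[OF e x M y lip sub f])
  qed
  also have "\<dots> = M * (3 + L) * (\<Sum>n\<in>A. sqrt (real (card (visits e x n T))))"
    by (simp add: sum_distrib_left)
  also have "\<dots> \<le> M * (3 + L) * sqrt (real (card A) * real T)"
    using sum_sqrt_card_visits_le[OF fin] M L by (intro mult_left_mono) auto
  also have "\<dots> \<le> M * (3 + L) * sqrt (real (card (nested_tree e x T)) * real T)"
  proof -
    have "finite (nested_tree e x T)"
      using nested_tree_split_tree[where x = x and T = T and t = T, OF e x] T split_tree_finite by auto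
    then have "card A \<le> card (nested_tree e x T)"
      using used_leaves_subset_tree[where x = x and T = T, OF e x] by (intro card_mono) (auto simp: A_def)
    then show ?thesis using M L by (intro mult_left_mono real_sqrt_le_mono mult_right_mono) auto
  qed
  finally show ?thesis .
qed

theorem theorem1:
  fixes e :: "nat \<Rightarrow> 'n::finite"
    and M L :: real and T :: nat
    and loss loss' :: "real \<Rightarrow> real \<Rightarrow> real"
    and x :: "nat \<Rightarrow> real ^ 'n" and y :: "nat \<Rightarrow> real"
  assumes "bij_betw e {..<CARD('n)} UNIV"
    and "T \<ge> 1" and "M > 0" and "L \<ge> 0"
    and "\<And>a b. a \<in> {0..1} \<Longrightarrow> b \<in> {0..1} \<Longrightarrow> loss a b \<in> {0..1}"
    and "\<And>b. b \<in> {0..1} \<Longrightarrow> convex_on {0..1} (\<lambda>a. loss a b)"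
    and "\<And>b. b \<in> {0..1} \<Longrightarrow> M-lipschitz_on {0..1} (\<lambda>a. loss a b)"
    and "\<And>a b. a \<in> {0..1} \<Longrightarrow> b \<in> {0..1} \<Longrightarrow> subgradient_at {0..1} (\<lambda>z. loss z b) a (loss' a b)"
    and "\<And>t. t \<in> {1..T} \<Longrightarrow> x t \<in> cbox 0 1"
    and "\<And>t. t \<in> {1..T} \<Longrightarrow> y t \<in> {0..1}"
  shows "(\<Sum>t=1..T. loss (nested_predict e M loss' x y t) (y t))
           - (INF f\<in>lipschitz_class L. \<Sum>t=1..T. loss (f (x t)) (y t))
         \<le> M * (3 + L) * sqrt (real (card (nested_tree e x T)) * real T)
       \<and> M * (3 + L) * sqrt (real (card (nested_tree e x T)) * real T)
         \<le> M * (3 + L) * (sqrt (real T)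
             + 2 * (3 * real CARD('n)) powr (real CARD('n) / (2 * (real CARD('n) + 2)))
                 * real T powr ((real CARD('n) + 1) / (real CARD('n) + 2)))"
proof
  define R where "R = M * (3 + L) * sqrt (real (card (nested_tree e x T)) * real T)"
  have "(\<lambda>_. 0) \<in> (lipschitz_class L :: (real ^ 'n \<Rightarrow> real) set)"
    using assms(4) by (auto simp: lipschitz_class_def lipschitz_on_def)
  then have "(\<Sum>t=1..T. loss (nested_predict e M loss' x y t) (y t)) - R
      \<le> (INF f\<in>lipschitz_class L. \<Sum>t=1..T. loss (f (x t)) (y t))"
  proof (intro cINF_greatest)
    fix f :: "real ^ 'n \<Rightarrow> real" assume "f \<in> lipschitz_class L"
    from nested_regret[where x = x and y = y and loss = loss and loss' = loss' and M = M and L = L,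
        OF assms(1,9,2,3,4,10,7,8) this]
    show "(\<Sum>t=1..T. loss (nested_predict e M loss' x y t) (y t)) - R \<le> (\<Sum>t=1..T. loss (f (x t)) (y t))"
      by (simp add: R_def)
  qed blast
  then show "(\<Sum>t=1..T. loss (nested_predict e M loss' x y t) (y t))
      - (INF f\<in>lipschitz_class L. \<Sum>t=1..T. loss (f (x t)) (y t)) \<le> R"
    by simp
  show "R \<le> M * (3 + L) * (sqrt (real T)
             + 2 * (3 * real CARD('n)) powr (real CARD('n) / (2 * (real CARD('n) + 2)))
                 * real T powr ((real CARD('n) + 1) / (real CARD('n) + 2)))"
    unfolding R_def using sqrt_card_tree_le[where x = x and T = T, OF assms(1,9,2)] assms(3,4) by (intro mult_left_mono) auto
qed

end
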